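(* Let $r_0\in(0,\pi/2]$, let $\gamma_{r_0}(s)=(r(s),\rho(s))$ be the maximal solution of $$r'=\sin r\cos\rho,\qquad \rho'=2\cos\rho+\sin\rho\cos r,$$ with $\gamma_{r_0}(0)=(r_0,0)$, and let $\alpha_{r_0}(s)=(\cos r(s),\sin r(s),z(s))$, where $z'=\sin\rho$ and $z(0)=0$. Let $\Lambda$ be the curve $\rho=-\arctan\frac{2}{\cos r}$, $r\in(0,\pi)\setminus\{\pi/2\}$. (1) If $r_0=\pi/2$, then $\gamma_{\pi/2}$ is anti-symmetric about the axes $r=\pi/2$, $\rho=0$ (i.e. its trace is invariant under $(r,\rho)\mapsto(\pi-r,-\rho)$). As $s>0$ increases, $\gamma_{\pi/2}$ intersects $\Lambda$ and $\gamma_{\pi/2}(s)\to(\pi,\arctan2)$ as $s\to\infty$; as $s<0$ decreases, $\gamma_{\pi/2}$ intersects $\Lambda$ and $\gamma_{\pi/2}(s)\to(0,-\arctan2)$ as $s\to-\infty$. The curve $\alpha_{\pi/2}$ is a vertical graph and is symmetric about the vertical plane $x=0$. (2) There exists $r_*\in(0,\pi/2)$ such that $\gamma_{r_*}(s)\to(\pi/2,\pi/2)$ as $s\to\infty$, while for $s<0$ the orbit $\gamma_{r_*}$ intersects $\Lambda$ and converges to $(0,-\arctan2)$ as $s\to-\infty$. The curve $\alpha_{r_*}$ is a vertical graph converging to the vertical line through the point $(0,1,0)$ as $s\to\infty$, with $r(s)\to\pi/2$ and $z(s)\to\infty$. (3) If $r_0\in(r_*,\pi/2)$, then as $s>0$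 increases $\gamma_{r_0}$ intersects $\Lambda$ and converges to $(\pi,\arctan2)$ as $s\to\infty$; as $s<0$ decreases $\gamma_{r_0}$ intersects $\Lambda$ and converges to $(0,-\arctan2)$ as $s\to-\infty$. The curve $\alpha_{r_0}$ is a vertical graph. (4) If $r_0\in(0,r_* )$, then as $s>0$ increases $\gamma_{r_0}$ lies at the left-hand side of $\gamma_{r_*}$ (smaller $r$), intersects the line $\rho=\pi/2$, where its $r$-coordinate attains a maximum, and then $\gamma_{r_0}(s)\to(0,\pi-\arctan2)$ as $s\to\infty$; as $s<0$ decreases $\gamma_{r_0}$ intersects $\Lambda$ and converges to $(0,-\arctan2)$ as $s\to-\infty$. The curve $\alpha_{r_0}$ fails to be a vertical graph (i.e. has vertical tangent) just at the time $s_0>0$ for which $\rho(s_0)=\pi/2$. In all cases, $\alpha_{r_0}$ is contained in $\{(x,y,z): y>0,\ z\ge0\}$, and it touches $\{z=0\}$, tangentially, exactly at the point $\alpha_{r_0}(0)$.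
   Context: The solutions are considered in the phase plane $\Theta=\{(r,\rho): r\in(0,\pi),\ \rho\in(-\pi,\pi)\}$. A vertical graph is a graph on the $xy$-plane: a curve $(\cos r(s),\sin r(s),z(s))$ is a vertical graph when $z$ is a function of $(x,y)=(\cos r,\sin r)$ along it. Geometric meaning: $\mathbb{H}^2\times\mathbb{R}$ is $\{(x,y,z): y>0\}$ with metric $\frac{dx^2+dy^2}{y^2}+dz^2$; the curves $\alpha_{r_0}$ are generating curves of surfaces $\Psi(s,t)=(e^t\cos r(s),e^t\sin r(s),z(s))$, invariant under the hyperbolic translations $(x,y,z)\mapsto(e^tx,e^ty,z)$, whose mean curvature $H$ (half the trace of the second fundamental form) satisfies $H=\langle N,\partial_z\rangle$ with $N$ the unit normal (hyperbolic v-grim reapers). *)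

theory Defs
  imports "HOL-Analysis.Analysis"
begin

text \<open>Points of the phase plane are pairs \<open>(r, \<rho>)\<close>; points of the ambient half-space model
  are triples \<open>(x, y, z)\<close>.\<close>

definition phase_plane :: "(real \<times> real) set" where
  "phase_plane = {0<..<pi} \<times> {-pi<..<pi}"

definition grim_field :: "real \<times> real \<Rightarrow> real \<times> real" where
  "grim_field = (\<lambda>(r, \<rho>). (sin r * cos \<rho>, 2 * cos \<rho> + sin \<rho> * cos r))"

definition solution_on :: "real set \<Rightarrow> (real \<Rightarrow> real \<times> real) \<Rightarrow> bool" where
  "solution_on T \<gamma> \<longleftrightarrow> open T \<and> is_interval T \<and>
     (\<forall>s\<in>T. \<gamma> s \<in> phase_plane \<and> (\<gamma> has_vector_derivative grim_field (\<gamma> s)) (at s))"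

text \<open>Maximality is with respect to extension of the solution inside the phase plane. The values
  of \<open>\<gamma>\<close> outside its interval of definition \<open>T\<close> are irrelevant.\<close>

definition maximal_solution :: "real \<times> real \<Rightarrow> real set \<Rightarrow> (real \<Rightarrow> real \<times> real) \<Rightarrow> bool" where
  "maximal_solution p T \<gamma> \<longleftrightarrow> 0 \<in> T \<and> \<gamma> 0 = p \<and> solution_on T \<gamma> \<and>
     (\<forall>T' \<gamma>'. solution_on T' \<gamma>' \<and> T \<subseteq> T' \<and> (\<forall>s\<in>T. \<gamma>' s = \<gamma> s) \<longrightarrow> T' = T)"

definition height_function :: "real set \<Rightarrow> (real \<Rightarrow> real \<times> real) \<Rightarrow> (real \<Rightarrow> real) \<Rightarrow> bool" where
  "height_function T \<gamma> z \<longleftrightarrow> z 0 = 0 \<and>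
     (\<forall>s\<in>T. (z has_real_derivative sin (snd (\<gamma> s))) (at s))"

definition gen_curve :: "(real \<Rightarrow> real \<times> real) \<Rightarrow> (real \<Rightarrow> real) \<Rightarrow> real \<Rightarrow> real \<times> real \<times> real" where
  "gen_curve \<gamma> z s = (cos (fst (\<gamma> s)), sin (fst (\<gamma> s)), z s)"

definition Lambda_curve :: "(real \<times> real) set" where
  "Lambda_curve = {(r, - arctan (2 / cos r)) | r. r \<in> {0<..<pi} - {pi/2}}"

definition vertical_graph_on :: "real set \<Rightarrow> (real \<Rightarrow> real \<times> real \<times> real) \<Rightarrow> bool" where
  "vertical_graph_on A \<alpha> \<longleftrightarrow>
     (\<exists>f :: real \<times> real \<Rightarrow> real. \<forall>s\<in>A. case \<alpha> s of (x, y, z) \<Rightarrow> z = f (x, y))"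

definition vertical_graph_near :: "(real \<Rightarrow> real \<times> real \<times> real) \<Rightarrow> real \<Rightarrow> bool" where
  "vertical_graph_near \<alpha> s \<longleftrightarrow> (\<exists>e>0. vertical_graph_on {s - e<..<s + e} \<alpha>)"

definition vertical_tangent_at :: "(real \<Rightarrow> real \<times> real \<times> real) \<Rightarrow> real \<Rightarrow> bool" where
  "vertical_tangent_at \<alpha> s \<longleftrightarrow>
     (\<exists>c. c \<noteq> 0 \<and> (\<alpha> has_vector_derivative (0, 0, c)) (at s))"

definition horizontal_tangent_at :: "(real \<Rightarrow> real \<times> real \<times> real) \<Rightarrow> real \<Rightarrow> bool" where
  "horizontal_tangent_at \<alpha> s \<longleftrightarrow>
     (\<exists>a b. (a, b) \<noteq> (0, 0) \<and> (\<alpha> has_vector_derivative (a, b, 0)) (at s))"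

end

theory Submission
  imports Defs
begin

text \<open>
  With \<open>c = cos r\<close> the system reads \<open>c' = - (1 - c\<^sup>2) cos \<rho>\<close>, \<open>\<rho>' = 2 cos \<rho> + c sin \<rho>\<close>. Its only rest points
  in the open strip \<open>0 < r < pi\<close>, up to periodicity in \<open>\<rho>\<close>, are the saddles \<open>(pi/2, pi/2)\<close> and
  \<open>(pi/2, - pi/2)\<close>. The orbits in question start on \<open>\<rho> = 0\<close>, where \<open>\<rho>' = 2\<close>, and their future stays in
  \<open>0 < \<rho> < pi\<close>; all that matters is what they do near the first saddle. Four facts decide this.

  Symmetry. The half turn about the saddle, \<open>(r, \<rho>) \<mapsto> (pi - r, pi - \<rho>)\<close>, maps orbits to orbits, and the half
  turn about \<open>(pi/2, 0)\<close> does so with time reversed. The past of an orbit launched at \<open>r\<^sub>0 \<le> pi/2\<close> is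
  therefore the future of one launched at \<open>pi - r\<^sub>0 \<ge> pi/2\<close>, and an orbit that ends to the upper
  left of the saddle is the half turn of one that ends to the lower right. Only one kind of end behaviour has
  to be studied.

  End behaviour. The quadrant \<open>r > pi/2\<close>, \<open>0 < \<rho> < pi/2\<close> is forward invariant (\<open>lower_right_invariant\<close>), and inside
  it \<open>c\<close> decreases to \<open>-1\<close> while \<open>\<rho>\<close> is attracted to the zero \<open>arctan 2\<close> of \<open>2 cos \<rho> - sin \<rho>\<close>
  (\<open>lower_right_limits\<close>). The limit is a node whose slow direction lies where \<open>\<rho>' < 0\<close>; so an
  orbit that starts with \<open>\<rho>' > 0\<close> has to cross the curve \<open>\<rho>' = 0\<close>, which is \<open>\<Lambda>\<close>, on the way (\<open>\<rho>_stationary\<close>).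

  Monotonicity. In the strip \<open>0 \<le> \<rho> \<le> pi\<close> the system in \<open>(c, \<rho>)\<close> is cooperative: \<open>c'\<close> increases with \<open>\<rho>\<close> and
  \<open>\<rho>'\<close> increases with \<open>c\<close>. Hence orbits launched from different points stay ordered, at equal times, for ever after
  (\<open>launched_orbit_comparison\<close>). To the lower left of the saddle the gap in \<open>c\<close> even grows
  (\<open>lower_left_gap_nondecreasing\<close>), so at most one launched orbit converges to the saddle.

  Existence of the separatrix. The launch points in \<open>[0, pi/2]\<close> whose orbit enters the lower right quadrant
  and those whose orbit enters the upper left quadrant form disjoint open sets, containing \<open>pi/2\<close> and \<open>0\<close>
  respectively. By connectedness some launch point belongs to neither, and its orbit has no choice but to
  converge to the saddle (\<open>separatrix_exists\<close>, \<open>saddle_limits\<close>). By monotonicity the orbits launched on either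
  side of it pass the saddle on the corresponding side (\<open>right_of_separatrix\<close>, \<open>left_of_separatrix\<close>).

  The field is globally Lipschitz in the plane, so orbits through all points exist for all times
  and depend continuously on the starting point. The orbits launched from \<open>(0, pi/2]\<close> never leave the
  phase plane, which is why maximal solutions in the phase plane are defined on the whole line
  (\<open>maximal_solution_launched\<close>). The statements about the generating curves follow from the signs of
  \<open>cos \<rho>\<close>, which tells where \<open>r\<close> is monotone, and of \<open>sin \<rho> = z'\<close>.
\<close>

section \<open>Differential inequalities on the line\<close>

text \<open>A function can only cross zero upwards if its derivative is positive at each of its zeros. All
  barriers for the orbits below have this form.\<close>

lemma positive_after_upcrossing:
  fixes f f' :: "real \<Rightarrow> real"
  assumes deriv: "\<And>s. a \<le> s \<Longrightarrow> s \<le> b \<Longrightarrow> (f has_real_derivative f' s) (at s)"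
    and start: "0 \<le> f a"
    and up: "\<And>s. a \<le> s \<Longrightarrow> s \<le> b \<Longrightarrow> f s = 0 \<Longrightarrow> 0 < f' s"
    and "a < t" "t \<le> b"
  shows "0 < f t"
proof (rule ccontr)
  assume "\<not> 0 < f t"
  then have ft: "f t \<le> 0" by simp
  have cont: "continuous_on {u..v} f" if "a \<le> u" "v \<le> b" for u v
    using that by (intro continuous_at_imp_continuous_on ballI DERIV_isCont[OF deriv]) auto
  have "\<exists>d>0. \<forall>h>0. h < d \<longrightarrow> 0 < f (a + h)"
  proof (cases "f a = 0")
    case True
    then show ?thesis
      using DERIV_pos_inc_right[OF deriv up, of a] assms(4,5) by auto
  next
    case False
    with start have "0 < f a" by simp
    moreover have "isCont f a"
      using deriv[of a] assms(4,5) DERIV_isCont by auto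
    ultimately have "\<forall>\<^sub>F x in at a. 0 < f x"
      by (simp add: isCont_def order_tendstoD(1))
    then obtain d where "d > 0" "\<And>x. x \<noteq> a \<Longrightarrow> dist x a < d \<Longrightarrow> 0 < f x"
      by (auto simp: eventually_at)
    then show ?thesis by (intro exI[of _ d]) (auto simp: dist_real_def)
  qed
  then obtain d where d: "d > 0" "\<And>h. h > 0 \<Longrightarrow> h < d \<Longrightarrow> 0 < f (a + h)" by auto
  obtain a' where a': "a < a'" "a' < t" "a' < a + d"
    using dense[of a "min t (a + d)"] d(1) \<open>a < t\<close> by auto
  then have "0 < f a'" using d(2)[of "a' - a"] by simp
  note a' = a'(1,2) this
  \<comment> \<open>The first time after a' at which f is not positive: there f vanishes and comes from above, against the sign of its derivative.\<close>
  define S where "S = {u \<in> {a'..t}. f u \<le> 0}"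
  have "closed S"
    unfolding S_def using cont[of a' t] a' assms(5)
    by (intro closed_Collect_le continuous_on_closed_Collect_le continuous_intros) auto
  moreover have "S \<noteq> {}" "bdd_below S"
    using a' ft by (auto simp: S_def intro!: bdd_belowI[of _ a'])
  ultimately have m: "Inf S \<in> S" by (simp add: closed_contains_Inf)
  define m where "m = Inf S"
  have mS: "m \<in> {a'..t}" "f m \<le> 0" using m by (auto simp: S_def m_def)
  have before: "0 < f u" if "a' \<le> u" "u < m" for u
    using cInf_lower[OF _ \<open>bdd_below S\<close>, of u] that mS(1) by (force simp: S_def m_def)
  have "a' \<noteq> m" using a'(3) mS(2) by auto
  then have "a' < m" using mS by auto
  have "f m = 0"
  proof (rule ccontr)
    assume "f m \<noteq> 0"
    with mS have "f m < 0" by simp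
    then obtain u where "a' \<le> u" "u \<le> m" "f u = 0"
      using IVT2'[of f m 0 a'] a' \<open>a' < m\<close> mS cont[of a' m] assms(5) by auto
    with before[of u] \<open>f m < 0\<close> show False by (cases "u = m") auto
  qed
  then obtain e where e: "e > 0" "\<And>h. h > 0 \<Longrightarrow> h < e \<Longrightarrow> f (m - h) < 0"
    using DERIV_pos_inc_left[OF deriv up, of m] mS a' assms(5) by auto
  obtain h where "0 < h" "h < e" "h < m - a'"
    using dense[of 0 "min e (m - a')"] e(1) \<open>a' < m\<close> by auto
  with e(2)[of h] before[of "m - h"] show False by auto
qed

text \<open>Gronwall's lemma for a one-sided bound. Adding a small multiple of \<open>exp ((L + 1) (s - a))\<close> turns the weak
  inequality into a strict one at the zeros, where the upcrossing argument applies.\<close>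

lemma nonneg_if_deriv_ge_neg_abs:
  fixes f f' :: "real \<Rightarrow> real"
  assumes deriv: "\<And>s. a \<le> s \<Longrightarrow> s \<le> b \<Longrightarrow> (f has_real_derivative f' s) (at s)"
    and start: "0 \<le> f a"
    and bound: "\<And>s. a \<le> s \<Longrightarrow> s \<le> b \<Longrightarrow> - L * \<bar>f s\<bar> \<le> f' s"
    and "a \<le> t" "t \<le> b"
  shows "0 \<le> f t"
proof (rule field_le_epsilon)
  fix \<epsilon> :: real assume "0 < \<epsilon>"
  define \<delta> where "\<delta> = \<epsilon> / exp ((L + 1) * (t - a))"
  have "0 < \<delta>" using \<open>0 < \<epsilon>\<close> by (simp add: \<delta>_def)
  define h where "h s = f s + \<delta> * exp ((L + 1) * (s - a))" for s
  have "0 < h t"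
  proof (cases "t = a")
    case True
    then show ?thesis using start \<open>0 < \<delta>\<close> by (simp add: h_def)
  next
    case False
    show ?thesis
    proof (rule positive_after_upcrossing[where f = h and a = a and b = b])
      fix s assume s: "a \<le> s" "s \<le> b"
      show "(h has_real_derivative (f' s + \<delta> * (exp ((L + 1) * (s - a)) * (L + 1)))) (at s)"
        unfolding h_def using deriv[OF s] by (auto intro!: derivative_eq_intros)
      assume "h s = 0"
      then have "f s = - (\<delta> * exp ((L + 1) * (s - a)))"
        by (simp add: h_def)
      then have "\<bar>f s\<bar> = \<delta> * exp ((L + 1) * (s - a))"
        using \<open>0 < \<delta>\<close> by simp
      with bound[OF s] have "- L * (\<delta> * exp ((L + 1) * (s - a))) \<le> f' s" by simp
      moreover have "0 < \<delta> * exp ((L + 1) * (s - a))" using \<open>0 < \<delta>\<close> by simp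
      ultimately show "0 < f' s + \<delta> * (exp ((L + 1) * (s - a)) * (L + 1))"
        by (simp add: algebra_simps)
    qed (use start \<open>0 < \<delta>\<close> assms(4,5) False in \<open>auto simp: h_def\<close>)
  qed
  then show "0 \<le> f t + \<epsilon>"
    by (simp add: h_def \<delta>_def)
qed

text \<open>The comparison function \<open>f a * exp (- L (s - a))\<close> is the solution of \<open>f' = - L f\<close>; it stays below \<open>f\<close>.\<close>

lemma positive_if_deriv_ge_neg_abs:
  fixes f f' :: "real \<Rightarrow> real"
  assumes deriv: "\<And>s. a \<le> s \<Longrightarrow> s \<le> b \<Longrightarrow> (f has_real_derivative f' s) (at s)"
    and start: "0 < f a"
    and bound: "\<And>s. a \<le> s \<Longrightarrow> s \<le> b \<Longrightarrow> - L * \<bar>f s\<bar> \<le> f' s"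
    and "0 \<le> L" "a \<le> t" "t \<le> b"
  shows "0 < f t"
proof -
  define h where "h s = f s - f a * exp (- L * (s - a))" for s
  have "0 \<le> h t"
  proof (rule nonneg_if_deriv_ge_neg_abs[where f = h and a = a and b = b and L = L])
    fix s assume s: "a \<le> s" "s \<le> b"
    show "(h has_real_derivative (f' s - f a * (exp (- L * (s - a)) * - L))) (at s)"
      unfolding h_def using deriv[OF s] by (auto intro!: derivative_eq_intros)
    have "0 < f a * exp (- L * (s - a))" using start by simp
    then have "\<bar>f s\<bar> \<le> \<bar>h s\<bar> + f a * exp (- L * (s - a))"
      unfolding h_def by linarith
    then have "L * \<bar>f s\<bar> \<le> L * (\<bar>h s\<bar> + f a * exp (- L * (s - a)))"
      using \<open>0 \<le> L\<close> by (rule mult_left_mono)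
    with bound[OF s]
    show "- L * \<bar>h s\<bar> \<le> f' s - f a * (exp (- L * (s - a)) * - L)"
      by (simp add: algebra_simps)
  qed (use assms in \<open>auto simp: h_def\<close>)
  moreover have "0 < f a * exp (- L * (t - a))" using start by simp
  ultimately show ?thesis by (simp add: h_def)
qed

text \<open>Kamke's comparison principle for a planar cooperative system, in the form of two functions each
  of which controls the decay of the other as long as it is nonnegative itself. It suffices to follow \<open>f\<close> up to
  its first zero: until then \<open>g\<close> is nonnegative, and then \<open>f\<close> cannot have reached zero. One initial value
  has to be strictly positive, the other may vanish.\<close>

lemma cooperative_pair:
  fixes f f' g g' :: "real \<Rightarrow> real"
  assumes df: "\<And>s. a \<le> s \<Longrightarrow> (f has_real_derivative f' s) (at s)"
    and dg: "\<And>s. a \<le> s \<Longrightarrow> (g has_real_derivative g' s) (at s)"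
    and start: "0 < f a" "0 \<le> g a"
    and f_bound: "\<And>s. a \<le> s \<Longrightarrow> 0 \<le> g s \<Longrightarrow> - L * \<bar>f s\<bar> \<le> f' s"
    and g_bound: "\<And>s. a \<le> s \<Longrightarrow> 0 \<le> f s \<Longrightarrow> - L * \<bar>g s\<bar> \<le> g' s"
    and L: "0 \<le> L" and t: "a \<le> t"
  shows "0 < f t" and "0 \<le> g t"
proof -
  have f_pos: "0 < f t" if "a \<le> t" for t
  proof (rule ccontr)
    assume "\<not> 0 < f t"
    define S where "S = {u \<in> {a..t}. f u \<le> 0}"
    have "continuous_on {a..t} f"
      by (intro continuous_at_imp_continuous_on ballI DERIV_isCont[OF df]) auto
    then have "closed S"
      unfolding S_def by (intro continuous_on_closed_Collect_le continuous_intros) auto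
    moreover have "S \<noteq> {}" "bdd_below S"
      using \<open>a \<le> t\<close> \<open>\<not> 0 < f t\<close> by (auto simp: S_def intro!: bdd_belowI[of _ a])
    ultimately have m: "Inf S \<in> S" by (simp add: closed_contains_Inf)
    define m where "m = Inf S"
    have mS: "a \<le> m" "m \<le> t" "f m \<le> 0" using m by (auto simp: S_def m_def)
    have before: "0 \<le> f u" if "a \<le> u" "u < m" for u
      using cInf_lower[OF _ \<open>bdd_below S\<close>, of u] that mS by (force simp: S_def m_def)
    have "0 \<le> g s" if "a \<le> s" "s < m" for s
    proof (rule nonneg_if_deriv_ge_neg_abs[where a = a and b = s and f = g and f' = g' and L = L])
      fix u assume "a \<le> u" "u \<le> s"
      with that show "(g has_real_derivative g' u) (at u)" "- L * \<bar>g u\<bar> \<le> g' u"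
        using dg g_bound before by auto
    qed (use that start in auto)
    moreover have "0 \<le> g m"
    proof (cases "a = m")
      case False
      have "(g \<longlongrightarrow> g m) (at_left m)"
        using DERIV_isCont[OF dg[OF mS(1)]]
        by (simp add: isCont_def filterlim_at_split)
      moreover have "\<forall>\<^sub>F s in at_left m. 0 \<le> g s"
        using False mS(1) \<open>\<And>s. a \<le> s \<Longrightarrow> s < m \<Longrightarrow> 0 \<le> g s\<close>
        by (auto simp: eventually_at_left_field intro!: exI[of _ a])
      ultimately show ?thesis by (intro tendsto_lowerbound) auto
    qed (use start in auto)
    ultimately have "0 \<le> g s" if "a \<le> s" "s \<le> m" for s
      using that by (cases "s = m") auto
    then have "0 < f m"
      using positive_if_deriv_ge_neg_abs[where a = a and b = m and f = f and f' = f' and L = L and t = m,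
          OF df start(1) f_bound L mS(1) order_refl] by blast
    with mS show False by simp
  qed
  then show "0 < f t" using t .
  show "0 \<le> g t"
    using nonneg_if_deriv_ge_neg_abs[where a = a and b = t and f = g and f' = g' and L = L and t = t,
        OF dg start(2) g_bound t order_refl] f_pos less_imp_le by blast
qed

text \<open>A linear decay forced by a vanishing perturbation: once \<open>g \<le> k e / 2\<close>, the excess of \<open>f\<close> over \<open>e / 2\<close> decays
  exponentially.\<close>

lemma tendsto_0_if_deriv_le:
  fixes f f' g :: "real \<Rightarrow> real"
  assumes deriv: "\<And>s. a \<le> s \<Longrightarrow> (f has_real_derivative f' s) (at s)"
    and nonneg: "\<And>s. a \<le> s \<Longrightarrow> 0 \<le> f s"
    and bound: "\<And>s. a \<le> s \<Longrightarrow> f' s \<le> - k * f s + g s"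
    and "0 < k" and g: "(g \<longlongrightarrow> 0) at_top"
  shows "(f \<longlongrightarrow> 0) at_top"
proof (rule order_tendstoI)
  fix e :: real assume "e < 0"
  then show "\<forall>\<^sub>F s in at_top. e < f s"
    using nonneg by (intro eventually_at_top_linorderI[of a]) (auto intro: less_le_trans)
next
  fix e :: real assume "0 < e"
  have "\<forall>\<^sub>F s in at_top. g s < k * (e/2)"
    using g \<open>0 < e\<close> \<open>0 < k\<close> by (intro order_tendstoD) auto
  then obtain b0 where b0: "\<And>s. b0 \<le> s \<Longrightarrow> g s < k * (e/2)"
    by (auto simp: eventually_at_top_linorder)
  define b where "b = max a b0"
  \<comment> \<open>Nonincreasing from the time b on.\<close>
  define h where "h s = (f s - e/2) * exp (k * s)" for s
  have "h s \<le> h b" if "b \<le> s" for s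
  proof (rule DERIV_nonpos_imp_nonincreasing[OF that])
    fix x assume "b \<le> x" "x \<le> s"
    then have x: "a \<le> x" "b0 \<le> x" by (auto simp: b_def)
    have "(h has_real_derivative (f' x + k * (f x - e/2)) * exp (k * x)) (at x)"
      unfolding h_def using deriv[OF x(1)]
      by (auto intro!: derivative_eq_intros simp: algebra_simps)
    moreover have "(f' x + k * (f x - e/2)) * exp (k * x) \<le> 0"
      using bound[OF x(1)] b0[OF x(2)] by (intro mult_nonpos_nonneg) (auto simp: algebra_simps)
    ultimately show "\<exists>y. (h has_real_derivative y) (at x) \<and> y \<le> 0" by blast
  qed
  then have ub: "f s \<le> e/2 + h b * exp (- k * s)" if "b \<le> s" for s
  proof -
    have "h s * exp (- k * s) \<le> h b * exp (- k * s)"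
      using \<open>\<And>s. b \<le> s \<Longrightarrow> h s \<le> h b\<close>[OF that] by (rule mult_right_mono) simp
    moreover have "h s * exp (- k * s) = f s - e/2"
      by (simp add: h_def exp_minus)
    ultimately show ?thesis by linarith
  qed
  have "((\<lambda>s. h b * exp (- k * s)) \<longlongrightarrow> h b * 0) at_top"
    using \<open>0 < k\<close>
    by (intro tendsto_intros filterlim_compose[OF exp_at_bot]
        filterlim_tendsto_neg_mult_at_bot[OF tendsto_const]) (auto simp: filterlim_ident)
  then have "\<forall>\<^sub>F s in at_top. h b * exp (- k * s) < e/2"
    using \<open>0 < e\<close> by (intro order_tendstoD) auto
  moreover have "\<forall>\<^sub>F s in at_top. b \<le> s" by (rule eventually_ge_at_top)
  ultimately show "\<forall>\<^sub>F s in at_top. f s < e"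
    by eventually_elim (use ub in fastforce)
qed

lemma filterlim_at_top_if_deriv_ge:
  fixes f f' :: "real \<Rightarrow> real"
  assumes deriv: "\<And>s. a \<le> s \<Longrightarrow> (f has_real_derivative f' s) (at s)"
    and bound: "\<And>s. a \<le> s \<Longrightarrow> m \<le> f' s" and "0 < m"
  shows "filterlim f at_top at_top"
proof (rule filterlim_at_top_mono)
  show "\<forall>\<^sub>F s in at_top. f a + m * (s - a) \<le> f s"
  proof (rule eventually_at_top_linorderI[of a])
    fix s assume "a \<le> s"
    have "f a - m * a \<le> f s - m * s"
    proof (rule DERIV_nonneg_imp_nondecreasing[OF \<open>a \<le> s\<close>, of "\<lambda>s. f s - m * s"])
      fix x assume "a \<le> x"
      then show "\<exists>y. ((\<lambda>s. f s - m * s) has_real_derivative y) (at x) \<and> 0 \<le> y"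
        using deriv[of x] bound[of x]
        by (intro exI[of _ "f' x - m"]) (auto intro!: derivative_eq_intros)
    qed
    then show "f a + m * (s - a) \<le> f s" by (simp add: algebra_simps)
  qed
  show "filterlim (\<lambda>s. f a + m * (s - a)) at_top at_top"
  proof -
    have "filterlim (\<lambda>s. m * s) at_top at_top"
      by (rule filterlim_tendsto_pos_mult_at_top[OF tendsto_const \<open>0 < m\<close> filterlim_ident])
    then have "filterlim (\<lambda>s. (f a - m * a) + m * s) at_top at_top"
      by (rule filterlim_tendsto_add_at_top[OF tendsto_const])
    then show ?thesis by (simp add: algebra_simps)
  qed
qed

lemma deriv_limit_eq_0:
  fixes f f' :: "real \<Rightarrow> real"
  assumes deriv: "\<And>s. a \<le> s \<Longrightarrow> (f has_real_derivative f' s) (at s)"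
    and f: "(f \<longlongrightarrow> l) at_top" and f': "(f' \<longlongrightarrow> m) at_top"
  shows "m = 0"
proof -
  have neg: "\<not> 0 < m" if "\<And>s. a \<le> s \<Longrightarrow> (f has_real_derivative f' s) (at s)"
    "(f \<longlongrightarrow> l) at_top" "(f' \<longlongrightarrow> m) at_top" for f f' :: "real \<Rightarrow> real" and l m
  proof
    assume "0 < m"
    then have "\<forall>\<^sub>F s in at_top. m/2 < f' s" by (intro order_tendstoD[OF that(3)]) auto
    then obtain b where "\<And>s. b \<le> s \<Longrightarrow> m/2 < f' s"
      by (auto simp: eventually_at_top_linorder)
    then have "filterlim f at_top at_top"
      using \<open>0 < m\<close> that(1)
      by (intro filterlim_at_top_if_deriv_ge[of "max a b" f f' "m/2"]) (auto intro: less_imp_le)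
    with that(2) show False
      using not_tendsto_and_filterlim_at_infinity[OF _ that(2)] filterlim_at_top_imp_at_infinity
      by (auto simp: trivial_limit_at_top_linorder)
  qed
  have "\<not> 0 < m" by (rule neg[OF deriv f f'])
  moreover have "\<not> 0 < - m"
    by (rule neg[of "\<lambda>s. - f s" "\<lambda>s. - f' s" "- l"])
      (use deriv f f' in \<open>auto intro!: tendsto_minus DERIV_minus\<close>)
  ultimately show ?thesis by simp
qed

lemma tendsto_at_top_if_nondecreasing:
  fixes f :: "real \<Rightarrow> real"
  assumes mono: "\<And>s t. a \<le> s \<Longrightarrow> s \<le> t \<Longrightarrow> f s \<le> f t" and bound: "\<And>s. a \<le> s \<Longrightarrow> f s \<le> b"
  shows "\<exists>l. (f \<longlongrightarrow> l) at_top \<and> (\<forall>s\<ge>a. f s \<le> l) \<and> l \<le> b"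
proof -
  define l where "l = (SUP s\<in>{a..}. f s)"
  have bdd: "bdd_above (f ` {a..})" using bound by (auto intro!: bdd_aboveI[of _ b])
  have le: "f s \<le> l" if "a \<le> s" for s
    unfolding l_def using bdd that by (intro cSUP_upper) auto
  have "(f \<longlongrightarrow> l) at_top"
  proof (rule order_tendstoI)
    fix y assume "y < l"
    then obtain s where s: "a \<le> s" "y < f s"
      unfolding l_def using bdd by (subst (asm) less_cSUP_iff) auto
    show "\<forall>\<^sub>F t in at_top. y < f t"
      using mono[OF s(1)] s(2) by (intro eventually_at_top_linorderI[of s]) (rule less_le_trans)
  next
    fix y assume "l < y"
    then show "\<forall>\<^sub>F t in at_top. f t < y"
      using le by (intro eventually_at_top_linorderI[of a]) (rule le_less_trans)
  qed
  moreover have "l \<le> b" unfolding l_def using bound by (intro cSUP_least) auto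
  ultimately show ?thesis using le by blast
qed

section \<open>Global solutions of Lipschitz differential equations\<close>

text \<open>The estimate behind the choice of the weight \<open>exp (- K t)\<close>: integration from \<open>0\<close> gains a factor \<open>1 / K\<close> in the
  weighted supremum norm.\<close>

lemma norm_integral_le_exp:
  fixes g :: "real \<Rightarrow> 'a::banach"
  assumes "continuous_on {0..t} g" and bound: "\<And>s. 0 \<le> s \<Longrightarrow> s \<le> t \<Longrightarrow> norm (g s) \<le> M * exp (K * s)"
    and "0 < K" "0 \<le> t" "0 \<le> M"
  shows "norm (exp (- K * t) *\<^sub>R integral {0..t} g) \<le> M / K"
proof -
  have "((\<lambda>s. M * exp (K * s)) has_integral M / K * exp (K * t) - M / K * exp (K * 0)) {0..t}"
    using \<open>0 < K\<close> \<open>0 \<le> t\<close>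
    by (intro fundamental_theorem_of_calculus)
      (auto intro!: derivative_eq_intros simp flip: has_real_derivative_iff_has_vector_derivative)
  note majorant = this
  have "norm (integral {0..t} g) \<le> integral {0..t} (\<lambda>s. M * exp (K * s))"
    using assms(1) bound majorant
    by (intro integral_norm_bound_integral) (auto simp: integrable_continuous_real has_integral_integrable)
  also have "\<dots> = M / K * exp (K * t) - M / K * exp (K * 0)"
    using majorant by (rule integral_unique)
  also have "\<dots> \<le> M / K * exp (K * t)"
    using \<open>0 < K\<close> \<open>0 \<le> M\<close> by simp
  finally have "norm (exp (- K * t) *\<^sub>R integral {0..t} g) \<le> exp (- K * t) * (M / K * exp (K * t))"
    unfolding norm_scaleR abs_exp_cancel by (rule mult_left_mono) simp
  also have "\<dots> = M / K" by (simp add: exp_minus)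
  finally show ?thesis .
qed

text \<open>Picard's iteration on the whole half line at once. The unknown is \<open>\<psi> t = exp (- K t) (x t - p)\<close>, which is
  bounded because solutions grow at most like \<open>exp (K t)\<close>, and for \<open>K > L\<close> the integral operator is a contraction
  on bounded continuous functions. Hence local solutions need not be continued step by step.\<close>

lemma lipschitz_ode_half_line:
  fixes f :: "'a::banach \<Rightarrow> 'a"
  assumes f: "L-lipschitz_on UNIV f"
  shows "\<exists>x. x 0 = p \<and> (\<forall>t\<ge>0. (x has_vector_derivative f (x t)) (at t within {0..}))"
proof -
  have L: "0 \<le> L" using f by (rule lipschitz_on_nonneg)
  define K where "K = L + 1"
  have K: "0 < K" using L by (simp add: K_def)
  have lip: "norm (f a - f b) \<le> L * norm (a - b)" for a b
    using lipschitz_onD[OF f, of a b] by (simp add: dist_norm)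
  have f_cont: "continuous_on S (\<lambda>s. f (g s))" if "continuous_on S g" for S and g :: "real \<Rightarrow> 'a"
    by (rule continuous_on_compose2[OF lipschitz_on_continuous_on[OF f] that]) auto
  define rhs where "rhs \<psi> s = f (p + exp (K * s) *\<^sub>R apply_bcontfun \<psi> s)" for \<psi> :: "real \<Rightarrow>\<^sub>C 'a" and s
  have rhs_cont: "continuous_on S (rhs \<psi>)" for S \<psi>
    unfolding rhs_def by (intro f_cont continuous_intros) auto
  \<comment> \<open>The maximum extends the operator to negative times by a constant, so that it acts on functions on the whole line.\<close>
  define J where "J \<psi> t = exp (- K * max 0 t) *\<^sub>R integral {0..max 0 t} (rhs \<psi>)" for \<psi> t
  have J_bcontfun: "J \<psi> \<in> bcontfun" for \<psi>
  proof (rule bcontfun_normI)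
    have "continuous_on {0..} (\<lambda>t. integral {0..t} (rhs \<psi>))"
      unfolding continuous_on_eq_continuous_within
    proof
      fix t :: real assume "t \<in> {0..}"
      then have "((\<lambda>u. integral {0..u} (rhs \<psi>)) has_vector_derivative rhs \<psi> t) (at t within {0..t + 1})"
        by (intro integral_has_vector_derivative rhs_cont) auto
      then have "continuous (at t within {0..t + 1}) (\<lambda>u. integral {0..u} (rhs \<psi>))"
        by (rule has_vector_derivative_continuous)
      moreover have "at t within {0..t + 1} = at t within {0..}"
        by (rule at_within_nhd[of _ "{..<t + 1}"]) auto
      ultimately show "continuous (at t within {0..}) (\<lambda>u. integral {0..u} (rhs \<psi>))" by simp
    qed
    then have "continuous_on UNIV (\<lambda>t. integral {0..max 0 t} (rhs \<psi>))"
      by (rule continuous_on_compose2) (auto intro!: continuous_intros)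
    then show "continuous_on UNIV (J \<psi>)"
      unfolding J_def by (intro continuous_intros)
    fix t
    show "norm (J \<psi> t) \<le> (norm (f p) + L * norm \<psi>) / K"
      unfolding J_def
    proof (rule norm_integral_le_exp)
      fix s :: real assume "0 \<le> s"
      have "norm (rhs \<psi> s) \<le> norm (f p) + L * norm (exp (K * s) *\<^sub>R apply_bcontfun \<psi> s)"
        using norm_triangle_sub[of "rhs \<psi> s" "f p"] lip[of "p + exp (K * s) *\<^sub>R apply_bcontfun \<psi> s" p]
        by (simp add: rhs_def)
      also have "\<dots> \<le> norm (f p) * exp (K * s) + L * (norm \<psi> * exp (K * s))"
      proof (rule add_mono)
        show "norm (f p) \<le> norm (f p) * exp (K * s)"
          using K \<open>0 \<le> s\<close> by (simp add: mult_le_cancel_left1)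
        show "L * norm (exp (K * s) *\<^sub>R apply_bcontfun \<psi> s) \<le> L * (norm \<psi> * exp (K * s))"
          using L norm_bounded[of \<psi> s] by (intro mult_left_mono) (auto simp: mult.commute)
      qed
      finally show "norm (rhs \<psi> s) \<le> (norm (f p) + L * norm \<psi>) * exp (K * s)"
        by (simp add: algebra_simps)
    qed (use L K rhs_cont in auto)
  qed
  define F where "F \<psi> = Bcontfun (J \<psi>)" for \<psi>
  have F: "apply_bcontfun (F \<psi>) t = J \<psi> t" for \<psi> t
    by (simp add: F_def Bcontfun_inverse J_bcontfun)
  have "\<exists>!\<psi>. F \<psi> = \<psi>"
  proof (rule banach_fix_type[of "L / K"])
    show "0 \<le> L / K" "L / K < 1" using L K by (auto simp: K_def)
    show "\<forall>\<psi> \<theta>. dist (F \<psi>) (F \<theta>) \<le> L / K * dist \<psi> \<theta>"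
    proof (intro allI dist_bound)
      fix \<psi> \<theta> :: "real \<Rightarrow>\<^sub>C 'a" and t
      have "J \<psi> t - J \<theta> t = exp (- K * max 0 t) *\<^sub>R integral {0..max 0 t} (\<lambda>s. rhs \<psi> s - rhs \<theta> s)"
        unfolding J_def
        by (subst integral_diff) (auto intro!: integrable_continuous_real rhs_cont simp: scaleR_diff_right)
      also have "norm \<dots> \<le> (L * dist \<psi> \<theta>) / K"
      proof (rule norm_integral_le_exp)
        fix s :: real
        have "norm (rhs \<psi> s - rhs \<theta> s)
            \<le> L * norm (exp (K * s) *\<^sub>R (apply_bcontfun \<psi> s - apply_bcontfun \<theta> s))"
          using lip[of "p + exp (K * s) *\<^sub>R apply_bcontfun \<psi> s" "p + exp (K * s) *\<^sub>R apply_bcontfun \<theta> s"]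
          by (simp add: rhs_def algebra_simps)
        also have "\<dots> \<le> L * (dist \<psi> \<theta> * exp (K * s))"
          using L dist_bounded[of \<psi> s \<theta>] by (intro mult_left_mono) (auto simp: mult.commute dist_norm)
        finally show "norm (rhs \<psi> s - rhs \<theta> s) \<le> L * dist \<psi> \<theta> * exp (K * s)"
          by (simp add: algebra_simps)
      qed (use L K rhs_cont in \<open>auto intro!: continuous_intros\<close>)
      finally show "dist (apply_bcontfun (F \<psi>) t) (apply_bcontfun (F \<theta>) t) \<le> L / K * dist \<psi> \<theta>"
        by (simp add: F dist_norm)
    qed
  qed
  then obtain \<psi> where \<psi>: "F \<psi> = \<psi>" by auto
  define x where "x t = p + exp (K * t) *\<^sub>R apply_bcontfun \<psi> t" for t
  have x_eq: "x t = p + integral {0..t} (\<lambda>s. f (x s))" if "0 \<le> t" for t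
  proof -
    have "apply_bcontfun \<psi> t = J \<psi> t" using F[of \<psi> t] \<psi> by simp
    moreover have "rhs \<psi> = (\<lambda>s. f (x s))" by (simp add: rhs_def x_def fun_eq_iff)
    ultimately show ?thesis using that by (simp add: x_def[of t] J_def exp_minus)
  qed
  have x_cont: "continuous_on S x" for S
    unfolding x_def by (intro continuous_intros) auto
  have "(x has_vector_derivative f (x t)) (at t within {0..})" if "0 \<le> t" for t
  proof -
    have "((\<lambda>u. p + integral {0..u} (\<lambda>s. f (x s))) has_vector_derivative 0 + f (x t)) (at t within {0..t + 1})"
      using that by (intro has_vector_derivative_add has_vector_derivative_const
          integral_has_vector_derivative f_cont x_cont) auto
    then have integral_deriv: "((\<lambda>u. p + integral {0..u} (\<lambda>s. f (x s))) has_vector_derivative f (x t))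
        (at t within {0..t + 1})"
      by (simp only: add_0)
    have "(x has_vector_derivative f (x t)) (at t within {0..t + 1})"
    proof (rule has_vector_derivative_transform[OF _ _ integral_deriv])
      show "t \<in> {0..t + 1}" using that by simp
      fix u assume "u \<in> {0..t + 1}"
      then show "x u = p + integral {0..u} (\<lambda>s. f (x s))" using x_eq[of u] by simp
    qed
    moreover have "at t within {0..t + 1} = at t within {0..}"
      using that by (intro at_within_nhd[of _ "{..<t + 1}"]) auto
    ultimately show ?thesis by simp
  qed
  moreover have "x 0 = p" using x_eq[of 0] by simp
  ultimately show ?thesis by blast
qed

lemma has_vector_derivative_reflect:
  assumes "(x has_vector_derivative d) (at (- t) within uminus ` S)"
  shows "((\<lambda>s. x (- s)) has_vector_derivative - d) (at t within S)"
proof -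
  have "(uminus has_vector_derivative (- 1 :: real)) (at t within S)"
    by (auto intro!: derivative_eq_intros)
  from vector_diff_chain_within[OF this assms] show ?thesis by (simp add: o_def)
qed

text \<open>The past is a future of the negated field; the two halves have the same derivative at \<open>0\<close>.\<close>

lemma lipschitz_ode_global:
  fixes f :: "'a::banach \<Rightarrow> 'a"
  assumes f: "L-lipschitz_on UNIV f"
  shows "\<exists>x. x 0 = p \<and> (\<forall>t. (x has_vector_derivative f (x t)) (at t))"
proof -
  obtain u where u: "u 0 = p" "\<And>t. 0 \<le> t \<Longrightarrow> (u has_vector_derivative f (u t)) (at t within {0..})"
    using lipschitz_ode_half_line[OF f, of p] by blast
  have "L-lipschitz_on UNIV (\<lambda>a. - f a)" using f by simp
  then obtain v where v: "v 0 = p" "\<And>t. 0 \<le> t \<Longrightarrow> (v has_vector_derivative - f (v t)) (at t within {0..})"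
    using lipschitz_ode_half_line[of L "\<lambda>a. - f a" p] by blast
  define x where "x t = (if t \<in> {0..} then u t else v (- t))" for t :: real
  have "(x has_vector_derivative f (x t)) (at t)" for t
  proof -
    have "(x has_vector_derivative (if t \<in> {0..} then f (u t) else f (v (- t)))) (at t within UNIV)"
      unfolding x_def
    proof (rule has_vector_derivative_If_within_closures[where T = "{..0}"])
      assume "t \<in> {..0} \<union> closure {0..} \<inter> closure {..0}"
      then have "t \<le> 0" by auto
      then have "(v has_vector_derivative - f (v (- t))) (at (- t) within uminus ` {..0})"
        using v(2)[of "- t"] by simp
      from has_vector_derivative_reflect[OF this]
      show "((\<lambda>s. v (- s)) has_vector_derivative f (v (- t)))
          (at t within {..0} \<union> closure {0..} \<inter> closure {..0})"
        by (simp add: Un_absorb2)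
    next
      assume "t \<in> {0..} \<union> closure {0..} \<inter> closure {..0}"
      then show "(u has_vector_derivative f (u t)) (at t within {0..} \<union> closure {0..} \<inter> closure {..0})"
        using u(2)[of t] by (auto simp: Un_absorb2)
    qed (use u v in auto)
    then show ?thesis by (cases "t \<in> {0..}") (simp_all add: x_def)
  qed
  moreover have "x 0 = p" using u by (simp add: x_def)
  ultimately show ?thesis by blast
qed

text \<open>In an inner product space the squared distance of two solutions has derivative at most \<open>2 L\<close> times
  itself, by the Cauchy-Schwarz inequality.\<close>

lemma lipschitz_ode_dist_le:
  fixes f :: "'a::real_inner \<Rightarrow> 'a"
  assumes f: "L-lipschitz_on UNIV f"
    and x: "\<And>s. 0 \<le> s \<Longrightarrow> s \<le> t \<Longrightarrow> (x has_vector_derivative f (x s)) (at s)"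
    and y: "\<And>s. 0 \<le> s \<Longrightarrow> s \<le> t \<Longrightarrow> (y has_vector_derivative f (y s)) (at s)"
    and "0 \<le> t"
  shows "dist (x t) (y t) \<le> exp (L * t) * dist (x 0) (y 0)"
proof -
  define D where "D s = (x s - y s) \<bullet> (x s - y s) * exp (- 2 * L * s)" for s
  have "D t \<le> D 0"
  proof (rule DERIV_nonpos_imp_nonincreasing[OF \<open>0 \<le> t\<close>])
    fix s assume s: "0 \<le> s" "s \<le> t"
    let ?d = "x s - y s" and ?e = "f (x s) - f (y s)"
    have "((\<lambda>s. x s - y s) has_derivative (\<lambda>h. h *\<^sub>R ?e)) (at s)"
      using has_vector_derivative_diff[OF x[OF s] y[OF s]] by (simp add: has_vector_derivative_def)
    from has_derivative_inner[OF this this]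
    have "((\<lambda>s. (x s - y s) \<bullet> (x s - y s)) has_real_derivative 2 * (?d \<bullet> ?e)) (at s)"
      unfolding has_field_derivative_def
      by (rule has_derivative_eq_rhs) (auto simp: fun_eq_iff inner_commute)
    then have "(D has_real_derivative 2 * (?d \<bullet> ?e) * exp (- 2 * L * s)
        + (?d \<bullet> ?d) * (exp (- 2 * L * s) * (- 2 * L))) (at s)"
      unfolding D_def by (auto intro!: derivative_eq_intros)
    \<comment> \<open>The Lipschitz bound in the direction of the difference.\<close>
    moreover have "?d \<bullet> ?e \<le> L * (?d \<bullet> ?d)"
    proof -
      have "?d \<bullet> ?e \<le> norm ?d * norm ?e" by (rule norm_cauchy_schwarz)
      also have "\<dots> \<le> norm ?d * (L * norm ?d)"
        using lipschitz_onD[OF f, of "x s" "y s"] by (intro mult_left_mono) (auto simp: dist_norm)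
      finally show ?thesis by (simp add: dot_square_norm power2_eq_square algebra_simps)
    qed
    then have "2 * (?d \<bullet> ?e - L * (?d \<bullet> ?d)) \<le> 0"
      by (intro mult_nonneg_nonpos) (simp, simp only: diff_le_0_iff_le)
    then have "2 * (?d \<bullet> ?e - L * (?d \<bullet> ?d)) * exp (- 2 * L * s) \<le> 0"
      by (rule mult_nonpos_nonneg) simp
    moreover have "2 * (?d \<bullet> ?e - L * (?d \<bullet> ?d)) * exp (- 2 * L * s)
      = 2 * (?d \<bullet> ?e) * exp (- 2 * L * s) + (?d \<bullet> ?d) * (exp (- 2 * L * s) * (- 2 * L))"
      by algebra
    ultimately show "\<exists>d. (D has_real_derivative d) (at s) \<and> d \<le> 0"
      by metis
  qed
  then have "D t * exp (2 * L * t) \<le> D 0 * exp (2 * L * t)"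
    by (rule mult_right_mono) simp
  moreover have "D t * exp (2 * L * t) = (norm (x t - y t))\<^sup>2" "D 0 = (norm (x 0 - y 0))\<^sup>2"
    by (simp_all add: D_def dot_square_norm exp_minus)
  ultimately have "(norm (x t - y t))\<^sup>2 \<le> (norm (x 0 - y 0))\<^sup>2 * exp (2 * L * t)"
    by simp
  moreover have "exp (2 * L * t) = (exp (L * t))\<^sup>2"
    by (simp add: mult.assoc flip: exp_double)
  ultimately have "(norm (x t - y t))\<^sup>2 \<le> (exp (L * t) * norm (x 0 - y 0))\<^sup>2"
    unfolding power_mult_distrib by (simp only: mult.commute)
  then show ?thesis
    unfolding dist_norm by (rule power2_le_imp_le) simp
qed

lemma lipschitz_ode_unique:
  fixes f :: "'a::real_inner \<Rightarrow> 'a"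
  assumes f: "L-lipschitz_on UNIV f"
    and "is_interval T" "0 \<in> T" "t \<in> T"
    and x: "\<And>s. s \<in> T \<Longrightarrow> (x has_vector_derivative f (x s)) (at s)"
    and y: "\<And>s. s \<in> T \<Longrightarrow> (y has_vector_derivative f (y s)) (at s)"
    and "x 0 = y 0"
  shows "x t = y t"
proof (cases "0 \<le> t")
  case True
  have "dist (x t) (y t) \<le> exp (L * t) * dist (x 0) (y 0)"
  proof (rule lipschitz_ode_dist_le[OF f])
    fix s assume "0 \<le> s" "s \<le> t"
    then have "s \<in> T" by (rule mem_is_interval_1_I[OF assms(2-4)])
    then show "(x has_vector_derivative f (x s)) (at s)" "(y has_vector_derivative f (y s)) (at s)"
      using x y by auto
  qed (use True in auto)
  then show ?thesis using \<open>x 0 = y 0\<close> by simp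
next
  case False
  have "dist (x (- (- t))) (y (- (- t))) \<le> exp (L * (- t)) * dist (x (- 0)) (y (- 0))"
  proof (rule lipschitz_ode_dist_le[where x = "\<lambda>s. x (- s)" and y = "\<lambda>s. y (- s)"])
    show "L-lipschitz_on UNIV (\<lambda>a. - f a)" using f by simp
    fix s assume "0 \<le> s" "s \<le> - t"
    then have "- s \<in> T"
      by (intro mem_is_interval_1_I[OF assms(2) assms(4,3)]) auto
    then show "((\<lambda>s. x (- s)) has_vector_derivative - f (x (- s))) (at s)"
      "((\<lambda>s. y (- s)) has_vector_derivative - f (y (- s))) (at s)"
      using has_vector_derivative_reflect[of x _ s UNIV] has_vector_derivative_reflect[of y _ s UNIV]
        x[of "- s"] y[of "- s"] by auto
  qed (use False in auto)
  then show ?thesis using \<open>x 0 = y 0\<close> by simp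
qed

section \<open>The grim reaper field and the lower right quadrant\<close>

lemma abs_sin_diff_le: "\<bar>sin x - sin y\<bar> \<le> \<bar>x - y\<bar>" for x y :: real
proof -
  have "\<bar>sin x - sin y\<bar> = 2 * \<bar>sin ((x - y) / 2)\<bar> * \<bar>cos ((x + y) / 2)\<bar>"
    by (simp add: sin_diff_sin abs_mult)
  also have "\<dots> \<le> 2 * \<bar>(x - y) / 2\<bar> * 1"
    by (intro mult_mono mult_nonneg_nonneg abs_sin_x_le_abs_x) auto
  finally show ?thesis by simp
qed

lemma abs_cos_diff_le: "\<bar>cos x - cos y\<bar> \<le> \<bar>x - y\<bar>" for x y :: real
  using abs_sin_diff_le[of "pi/2 - x" "pi/2 - y"] by (simp add: sin_diff abs_minus_commute)

lemma abs_mult_diff_le: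
  fixes a b c d :: real
  assumes "\<bar>a\<bar> \<le> 1" "\<bar>d\<bar> \<le> 1"
  shows "\<bar>a * b - c * d\<bar> \<le> \<bar>b - d\<bar> + \<bar>a - c\<bar>"
proof -
  have "a * b - c * d = a * (b - d) + (a - c) * d" by (simp add: algebra_simps)
  also have "\<bar>\<dots>\<bar> \<le> \<bar>a\<bar> * \<bar>b - d\<bar> + \<bar>a - c\<bar> * \<bar>d\<bar>"
    using abs_triangle_ineq[of "a * (b - d)" "(a - c) * d"] by (simp add: abs_mult)
  also have "\<dots> \<le> 1 * \<bar>b - d\<bar> + \<bar>a - c\<bar> * 1"
    using assms by (intro add_mono mult_mono) auto
  finally show ?thesis by simp
qed

lemma sin_mult_cos_ge: "- 1 * \<bar>u\<bar> \<le> sin u * cos v" for u v :: real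
proof -
  have "\<bar>sin u * cos v\<bar> \<le> \<bar>u\<bar> * 1"
    unfolding abs_mult by (intro mult_mono abs_sin_x_le_abs_x) auto
  then show ?thesis by linarith
qed

lemma sin_plus_cos_ge_1:
  assumes "0 \<le> u" "u \<le> pi/2"
  shows "1 \<le> sin u + cos u"
proof -
  have sc: "0 \<le> sin u" "0 \<le> cos u"
    using assms by (auto intro!: sin_ge_zero cos_ge_zero)
  have "(sin u)\<^sup>2 \<le> sin u" "(cos u)\<^sup>2 \<le> cos u"
    using sc by (auto simp: power2_eq_square intro!: mult_left_le)
  then show ?thesis using sin_cos_squared_add[of u] by linarith
qed

lemma lipschitz_grim_field: "6-lipschitz_on UNIV grim_field"
proof (rule lipschitz_onI)
  fix p q :: "real \<times> real"
  obtain a b c d where pq: "p = (a, b)" "q = (c, d)" by fastforce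
  have first: "\<bar>sin a * cos b - sin c * cos d\<bar> \<le> \<bar>b - d\<bar> + \<bar>a - c\<bar>"
    using abs_mult_diff_le[of "sin a" "cos d" "cos b" "sin c"] abs_sin_diff_le[of a c] abs_cos_diff_le[of b d]
    by simp
  have second: "\<bar>2 * (cos b - cos d)\<bar> \<le> 2 * \<bar>b - d\<bar>"
    unfolding abs_mult using abs_cos_diff_le[of b d] by simp
  have third: "\<bar>sin b * cos a - sin d * cos c\<bar> \<le> \<bar>b - d\<bar> + \<bar>a - c\<bar>"
    using abs_mult_diff_le[of "sin b" "cos c" "cos a" "sin d"] abs_sin_diff_le[of b d] abs_cos_diff_le[of a c]
    by simp
  have "dist (grim_field p) (grim_field q)
      \<le> \<bar>sin a * cos b - sin c * cos d\<bar> + \<bar>2 * (cos b - cos d) + (sin b * cos a - sin d * cos c)\<bar>"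
    using norm_Pair_le[of "sin a * cos b - sin c * cos d" "2 * (cos b - cos d) + (sin b * cos a - sin d * cos c)"]
    by (simp add: pq grim_field_def dist_norm algebra_simps)
  also have "\<dots> \<le> (\<bar>b - d\<bar> + \<bar>a - c\<bar>) + (2 * \<bar>b - d\<bar> + (\<bar>b - d\<bar> + \<bar>a - c\<bar>))"
    by (intro add_mono first order_trans[OF abs_triangle_ineq] second third)
  also have "\<dots> = 4 * \<bar>b - d\<bar> + 2 * \<bar>a - c\<bar>" by simp
  also have "\<dots> \<le> 4 * dist p q + 2 * dist p q"
    using norm_fst_le[of "a - c" "b - d"] norm_snd_le[of "b - d" "a - c"]
    by (intro add_mono mult_left_mono) (simp_all add: pq dist_norm)
  finally show "dist (grim_field p) (grim_field q) \<le> 6 * dist p q" by simp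
qed simp

text \<open>Orbits of the field in the whole plane, in coordinates. That the orbits of interest remain in the
  phase plane is derived from their starting points.\<close>

locale grim_orbit =
  fixes r \<rho> :: "real \<Rightarrow> real"
  assumes r_deriv: "(r has_real_derivative sin (r s) * cos (\<rho> s)) (at s)"
    and \<rho>_deriv: "(\<rho> has_real_derivative 2 * cos (\<rho> s) + sin (\<rho> s) * cos (r s)) (at s)"
begin

lemma cos_r_deriv: "((\<lambda>s. cos (r s)) has_real_derivative - (sin (r s))\<^sup>2 * cos (\<rho> s)) (at s)"
  by (rule derivative_eq_intros r_deriv refl)+ (simp add: power2_eq_square)

lemma cont [continuous_intros]: "continuous_on A r" "continuous_on A \<rho>"
  by (auto intro!: continuous_at_imp_continuous_on DERIV_isCont[OF r_deriv] DERIV_isCont[OF \<rho>_deriv])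

text \<open>The half turn about \<open>(pi/2, 0)\<close> reverses time.\<close>

lemma reflect: "grim_orbit (\<lambda>s. pi - r (- s)) (\<lambda>s. - \<rho> (- s))"
proof
  fix s
  have "((\<lambda>s. r (- s)) has_real_derivative - (sin (r (- s)) * cos (\<rho> (- s)))) (at s)"
    using r_deriv[of "- s"] by (simp add: DERIV_mirror)
  from DERIV_diff[OF DERIV_const[of pi] this]
  show "((\<lambda>s. pi - r (- s)) has_real_derivative sin (pi - r (- s)) * cos (- \<rho> (- s))) (at s)"
    by simp
  have "((\<lambda>s. \<rho> (- s)) has_real_derivative - (2 * cos (\<rho> (- s)) + sin (\<rho> (- s)) * cos (r (- s)))) (at s)"
    using \<rho>_deriv[of "- s"] by (simp only: DERIV_mirror)
  from DERIV_minus[OF this] show "((\<lambda>s. - \<rho> (- s)) has_real_derivative 2 * cos (- \<rho> (- s)) + sin (- \<rho> (- s)) * cos (pi - r (- s))) (at s)"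
    by (simp add: add.commute)
qed

text \<open>The half turn about the saddle \<open>(pi/2, pi/2)\<close> keeps the direction of time.\<close>

lemma rotate: "grim_orbit (\<lambda>s. pi - r s) (\<lambda>s. pi - \<rho> s)"
  by unfold_locales (auto intro!: derivative_eq_intros r_deriv \<rho>_deriv)

text \<open>The lines \<open>r = 0\<close> and \<open>r = pi\<close> consist of orbits, and \<open>\<bar>r'\<bar>\<close> is at most the distance to them; so they are not
  reached in finite time.\<close>

lemma r_range_forward:
  assumes "r 0 \<in> {0<..<pi}" "0 \<le> s"
  shows "r s \<in> {0<..<pi}"
proof -
  have "0 < r s"
    by (rule positive_if_deriv_ge_neg_abs[where f = r and a = 0 and b = s and L = 1, OF r_deriv])
      (use assms sin_mult_cos_ge in auto)
  moreover have "0 < pi - r s"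
  proof (rule positive_if_deriv_ge_neg_abs[where f = "\<lambda>s. pi - r s" and a = 0 and b = s and L = 1])
    fix u
    show "((\<lambda>s. pi - r s) has_real_derivative - (sin (r u) * cos (\<rho> u))) (at u)"
      by (auto intro!: derivative_eq_intros r_deriv)
    show "- 1 * \<bar>pi - r u\<bar> \<le> - (sin (r u) * cos (\<rho> u))"
      using sin_mult_cos_ge[of "pi - r u" "pi - \<rho> u"] by simp
  qed (use assms in auto)
  ultimately show ?thesis by simp
qed

lemma r_range:
  assumes "r 0 \<in> {0<..<pi}"
  shows "r s \<in> {0<..<pi}"
proof (cases "0 \<le> s")
  case True
  with assms show ?thesis by (rule r_range_forward)
next
  case False
  interpret R: grim_orbit "\<lambda>s. pi - r (- s)" "\<lambda>s. - \<rho> (- s)" by (rule reflect)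
  have "pi - r (- (- s)) \<in> {0<..<pi}"
    by (rule R.r_range_forward) (use assms False in auto)
  then show ?thesis by simp
qed

lemma \<rho>_pos:
  assumes "0 \<le> \<rho> a" "a < s"
  shows "0 < \<rho> s"
proof (rule positive_after_upcrossing[where f = \<rho> and a = a and b = s])
  fix u
  show "(\<rho> has_real_derivative 2 * cos (\<rho> u) + sin (\<rho> u) * cos (r u)) (at u)" by (rule \<rho>_deriv)
  show "0 < 2 * cos (\<rho> u) + sin (\<rho> u) * cos (r u)" if "\<rho> u = 0" using that by simp
qed (use assms in simp_all)

lemma \<rho>_less_pi:
  assumes "\<rho> a \<le> pi" "a < s"
  shows "\<rho> s < pi"
proof -
  interpret R: grim_orbit "\<lambda>s. pi - r s" "\<lambda>s. pi - \<rho> s" by (rule rotate)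
  show ?thesis using R.\<rho>_pos[of a s] assms by simp
qed

lemma cos_r_decreasing:
  assumes "a \<le> b" and "\<And>s. a \<le> s \<Longrightarrow> s \<le> b \<Longrightarrow> 0 \<le> cos (\<rho> s)"
  shows "cos (r b) \<le> cos (r a)"
  by (rule DERIV_nonpos_imp_nonincreasing[OF assms(1)])
    (use cos_r_deriv assms(2) in \<open>force intro: mult_nonneg_nonneg\<close>)

text \<open>In terms of \<open>g = - cos r\<close> and \<open>f = pi/2 - \<rho>\<close> the system is cooperative near the saddle: \<open>g' = sin\<^sup>2 r sin f\<close>
  and \<open>f' = - 2 sin f + g cos f\<close>. So the quadrant in which both are nonnegative cannot be left.\<close>

lemma lower_right_invariant:
  assumes "0 \<le> \<rho> a" "\<rho> a < pi/2" "cos (r a) \<le> 0" "a \<le> s"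
  shows "\<rho> s < pi/2" and "cos (r s) \<le> 0"
proof -
  have range: "0 \<le> \<rho> s \<and> \<rho> s \<le> pi" if "a \<le> s" for s
    using \<rho>_pos[of a s] \<rho>_less_pi[of a s] assms that by (cases "a = s") auto
  note coop = cooperative_pair[where a = a and L = 2 and t = s
      and f = "\<lambda>s. pi/2 - \<rho> s" and f' = "\<lambda>s. - (2 * cos (\<rho> s) + sin (\<rho> s) * cos (r s))"
      and g = "\<lambda>s. - cos (r s)" and g' = "\<lambda>s. (sin (r s))\<^sup>2 * cos (\<rho> s)"]
  have f: "((\<lambda>s. pi/2 - \<rho> s) has_real_derivative - (2 * cos (\<rho> s) + sin (\<rho> s) * cos (r s))) (at s)" for s
    by (auto intro!: derivative_eq_intros \<rho>_deriv)
  have g: "((\<lambda>s. - cos (r s)) has_real_derivative (sin (r s))\<^sup>2 * cos (\<rho> s)) (at s)" for s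
    using DERIV_minus[OF cos_r_deriv, of s] by simp
  have f_bound: "- 2 * \<bar>pi/2 - \<rho> s\<bar> \<le> - (2 * cos (\<rho> s) + sin (\<rho> s) * cos (r s))"
    if "a \<le> s" "0 \<le> - cos (r s)" for s
  proof -
    have "sin (\<rho> s) * cos (r s) \<le> 0"
      using range[OF that(1)] that(2) by (intro mult_nonneg_nonpos sin_ge_zero) auto
    moreover have "cos (\<rho> s) \<le> \<bar>pi/2 - \<rho> s\<bar>"
      using abs_sin_x_le_abs_x[of "pi/2 - \<rho> s"] by (simp add: sin_diff)
    moreover have "0 \<le> \<bar>pi/2 - \<rho> s\<bar>" by simp
    ultimately show ?thesis by (simp only: mult_minus_left minus_add_distrib) argo
  qed
  have g_bound: "- 2 * \<bar>- cos (r s)\<bar> \<le> (sin (r s))\<^sup>2 * cos (\<rho> s)"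
    if "a \<le> s" "0 \<le> pi/2 - \<rho> s" for s
  proof -
    have "0 \<le> (sin (r s))\<^sup>2 * cos (\<rho> s)"
      using range[OF that(1)] that(2) by (intro mult_nonneg_nonneg cos_ge_zero) auto
    then show ?thesis by (rule order_trans[rotated]) simp
  qed
  show "\<rho> s < pi/2" "cos (r s) \<le> 0"
    using coop[OF f g _ _ f_bound g_bound _ assms(4)] assms by auto
qed

lemma cos_r_neg_persists:
  assumes \<rho>: "\<And>s. a \<le> s \<Longrightarrow> 0 \<le> \<rho> s \<and> \<rho> s < pi/2"
    and "cos (r a) < 0" "a \<le> s"
  shows "cos (r s) \<le> cos (r a)"
  using assms by (intro cos_r_decreasing cos_ge_zero) force+

text \<open>A bound for \<open>\<rho>\<close> away from \<open>pi/2\<close>. It makes \<open>r\<close> advance at a definite rate.\<close>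

lemma \<rho>_barrier:
  assumes \<rho>: "\<And>s. a \<le> s \<Longrightarrow> 0 \<le> \<rho> s \<and> \<rho> s < pi/2"
    and "cos (r a) < 0"
  obtains \<delta> where "0 < \<delta>" "\<And>s. a \<le> s \<Longrightarrow> \<delta> \<le> cos (\<rho> s)"
proof -
  define k where "k = - cos (r a)"
  have k: "0 < k" using assms(2) by (simp add: k_def)
  \<comment> \<open>At arctan (2 / k) the bound for the derivative of \<rho> is 0; the 3 makes it negative.\<close>
  define m where "m = max (\<rho> a) (arctan (3 / k))"
  have "0 < arctan (3 / k)" using k by simp
  then have m: "0 < m" "m < pi/2" "arctan (3 / k) \<le> m" "\<rho> a \<le> m"
    using \<rho>[of a] arctan_ubound[of "3 / k"] by (auto simp: m_def less_max_iff_disj)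
  have cm: "0 < cos m" using m by (intro cos_gt_zero) auto
  have "arctan (tan m) = m" using m by (intro arctan_tan) auto
  with m(3) have "3 / k \<le> tan m" by (metis arctan_le_iff)
  then have sm: "3 * cos m \<le> k * sin m"
    using k cm by (simp add: tan_def field_simps)
  have "\<rho> s \<le> m" if "a \<le> s" for s
  proof (cases "a = s")
    case False
    have "0 < m - \<rho> s"
    proof (rule positive_after_upcrossing[where f = "\<lambda>s. m - \<rho> s" and a = a and b = s])
      fix u assume u: "a \<le> u"
      show "((\<lambda>s. m - \<rho> s) has_real_derivative - (2 * cos (\<rho> u) + sin (\<rho> u) * cos (r u))) (at u)"
        by (auto intro!: derivative_eq_intros \<rho>_deriv)
      assume "m - \<rho> u = 0"
      then have [simp]: "\<rho> u = m" by simp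
      have "cos (r u) \<le> - k"
        using cos_r_neg_persists[OF assms u] by (simp add: k_def)
      then have "sin m * cos (r u) \<le> sin m * - k"
        using m by (intro mult_left_mono sin_ge_zero) auto
      with sm cm show "0 < - (2 * cos (\<rho> u) + sin (\<rho> u) * cos (r u))"
        by (simp add: mult.commute)
    qed (use m that False in auto)
    then show ?thesis by simp
  qed (use m in auto)
  then have "cos m \<le> cos (\<rho> s)" if "a \<le> s" for s
    using \<rho>[OF that] m that by (intro cos_monotone_0_pi_le) auto
  with cm show ?thesis by (rule that)
qed

text \<open>With \<open>e = 1 + cos r\<close> and \<open>p = sin \<rho> - 2 cos \<rho>\<close>, the first quantity decays at a rate given by the barrier.
  Since \<open>\<rho>' = - p + e sin \<rho>\<close>, the second is damped as well, with a perturbation that vanishes with \<open>e\<close>.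
  The limit \<open>arctan 2\<close> is the zero of \<open>p\<close>.\<close>

lemma lower_right_limits:
  assumes \<rho>: "\<And>s. a \<le> s \<Longrightarrow> 0 \<le> \<rho> s \<and> \<rho> s < pi/2"
    and "cos (r a) < 0"
  shows "((\<lambda>s. cos (r s)) \<longlongrightarrow> -1) at_top" and "(\<rho> \<longlongrightarrow> arctan 2) at_top"
proof -
  obtain \<delta> where \<delta>: "0 < \<delta>" "\<And>s. a \<le> s \<Longrightarrow> \<delta> \<le> cos (\<rho> s)"
    using \<rho>_barrier[OF assms] by blast
  have neg: "cos (r s) \<le> 0" if "a \<le> s" for s
    using cos_r_neg_persists[OF assms that] assms(2) by simp
  have e: "((\<lambda>s. 1 + cos (r s)) \<longlongrightarrow> 0) at_top"
  proof (rule tendsto_0_if_deriv_le[where g = "\<lambda>_. 0" and k = \<delta> and a = a])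
    fix s assume s: "a \<le> s"
    show "((\<lambda>s. 1 + cos (r s)) has_real_derivative - (sin (r s))\<^sup>2 * cos (\<rho> s)) (at s)"
      using DERIV_add[OF DERIV_const cos_r_deriv] by simp
    show nonneg: "0 \<le> 1 + cos (r s)" using cos_ge_minus_one[of "r s"] by linarith
    have "\<delta> * (1 + cos (r s)) * 1 \<le> cos (\<rho> s) * (1 + cos (r s)) * (1 - cos (r s))"
      using \<delta> s nonneg neg[OF s] by (intro mult_mono mult_nonneg_nonneg) (auto intro: order_trans[of 0 \<delta>])
    then show "- (sin (r s))\<^sup>2 * cos (\<rho> s) \<le> - \<delta> * (1 + cos (r s)) + 0"
      unfolding sin_squared_eq by (simp add: power2_eq_square algebra_simps)
  qed (use \<delta> in auto)
  then show "((\<lambda>s. cos (r s)) \<longlongrightarrow> -1) at_top"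
    using tendsto_diff[OF e tendsto_const[of 1]] by simp
  define p where "p s = sin (\<rho> s) - 2 * cos (\<rho> s)" for s
  have "((\<lambda>s. (p s)\<^sup>2) \<longlongrightarrow> 0) at_top"
  proof (rule tendsto_0_if_deriv_le[where g = "\<lambda>s. 18 * (1 + cos (r s))" and k = 2 and a = a])
    fix s assume s: "a \<le> s"
    let ?q = "cos (\<rho> s) + 2 * sin (\<rho> s)" and ?e = "1 + cos (r s)"
    show "((\<lambda>s. (p s)\<^sup>2) has_real_derivative
        2 * p s * (?q * (2 * cos (\<rho> s) + sin (\<rho> s) * cos (r s)))) (at s)"
      unfolding p_def by (auto intro!: derivative_eq_intros \<rho>_deriv simp: algebra_simps)
    have sc: "0 \<le> sin (\<rho> s)" "0 \<le> cos (\<rho> s)"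
      using \<rho>[OF s] by (auto intro!: sin_ge_zero cos_ge_zero)
    have q: "1 \<le> ?q" "?q \<le> 3"
      using sin_plus_cos_ge_1[of "\<rho> s"] \<rho>[OF s] sc cos_le_one[of "\<rho> s"] sin_le_one[of "\<rho> s"] by linarith+
    have "\<bar>p s\<bar> \<le> 3"
      unfolding p_def abs_le_iff using sc cos_le_one[of "\<rho> s"] sin_le_one[of "\<rho> s"] by (intro conjI; linarith)
    moreover have "\<bar>sin (\<rho> s)\<bar> \<le> 1" by simp
    moreover have e0: "0 \<le> ?e" using cos_ge_minus_one[of "r s"] by linarith
    ultimately have "\<bar>p s\<bar> * (?q * (\<bar>sin (\<rho> s)\<bar> * ?e)) \<le> 3 * (3 * (1 * ?e))"
      using q by (intro mult_mono mult_nonneg_nonneg) auto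
    moreover have "\<bar>p s * (?q * (sin (\<rho> s) * ?e))\<bar> = \<bar>p s\<bar> * (?q * (\<bar>sin (\<rho> s)\<bar> * ?e))"
      unfolding abs_mult using q e0 by simp
    ultimately have "p s * (?q * (sin (\<rho> s) * ?e)) \<le> 9 * ?e"
      by linarith
    moreover have "1 * (p s)\<^sup>2 \<le> ?q * (p s)\<^sup>2"
      using q by (intro mult_right_mono) auto
    moreover have "2 * p s * (?q * (2 * cos (\<rho> s) + sin (\<rho> s) * cos (r s)))
        = 2 * (p s * (?q * (sin (\<rho> s) * ?e))) - 2 * (?q * (p s)\<^sup>2)"
      unfolding p_def by algebra
    ultimately show "2 * p s * (?q * (2 * cos (\<rho> s) + sin (\<rho> s) * cos (r s)))
        \<le> - 2 * (p s)\<^sup>2 + 18 * ?e" by linarith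
    show "0 \<le> (p s)\<^sup>2" by simp
  next
    show "((\<lambda>s. 18 * (1 + cos (r s))) \<longlongrightarrow> 0) at_top"
      by (rule tendsto_mult_right_zero[OF e])
  qed simp
  from tendsto_real_sqrt[OF this] have "((\<lambda>s. \<bar>p s\<bar> / \<delta>) \<longlongrightarrow> 0) at_top"
    using tendsto_divide[OF _ tendsto_const, of _ 0 at_top \<delta>] \<delta> by simp
  then have "((\<lambda>s. tan (\<rho> s) - 2) \<longlongrightarrow> 0) at_top"
  proof (rule Lim_null_comparison[rotated], intro eventually_at_top_linorderI)
    fix s assume s: "a \<le> s"
    have pos: "0 < cos (\<rho> s)" using \<delta>(1) \<delta>(2)[OF s] by linarith
    then have "tan (\<rho> s) - 2 = p s / cos (\<rho> s)"
      by (simp add: tan_def p_def diff_divide_distrib)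
    then have "norm (tan (\<rho> s) - 2) = \<bar>p s\<bar> / cos (\<rho> s)"
      using pos by simp
    also have "\<dots> \<le> \<bar>p s\<bar> / \<delta>"
      using \<delta>(1) \<delta>(2)[OF s] by (intro frac_le) auto
    finally show "norm (tan (\<rho> s) - 2) \<le> \<bar>p s\<bar> / \<delta>" .
  qed
  then have "((\<lambda>s. tan (\<rho> s)) \<longlongrightarrow> 2) at_top" by (rule LIM_zero_cancel)
  then have lim: "((\<lambda>s. arctan (tan (\<rho> s))) \<longlongrightarrow> arctan 2) at_top" by (rule tendsto_arctan)
  have "arctan (tan (\<rho> s)) = \<rho> s" if "a \<le> s" for s
    using \<rho>[OF that] by (intro arctan_tan) linarith+
  then have "\<forall>\<^sub>F s in at_top. arctan (tan (\<rho> s)) = \<rho> s"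
    by (intro eventually_at_top_linorderI)
  with lim show "(\<rho> \<longlongrightarrow> arctan 2) at_top" by (rule Lim_transform_eventually)
qed

text \<open>The orbit crosses \<open>\<Lambda>\<close>, because near the limit point the distance \<open>1 + cos r\<close> to the boundary decays
  more slowly than \<open>\<rho>'\<close> would do by itself and then acts as a negative forcing: the quotient
  \<open>q = \<rho>' / (1 + cos r)\<close> satisfies
  \<open>q' = q (cos \<rho> - 2 sin \<rho>) - (1 - cos r) sin \<rho> cos \<rho>\<close>. At \<open>\<rho> = arctan 2\<close> the factor of \<open>q\<close> is negative, and the last
  term tends to \<open>- 4/5\<close>. A quotient that stayed positive would thus tend to \<open>- \<infinity>\<close>.\<close>

lemma \<rho>_stationary:
  assumes r: "\<And>s. r s \<in> {0<..<pi}"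
    and \<rho>: "\<And>s. a \<le> s \<Longrightarrow> 0 \<le> \<rho> s \<and> \<rho> s < pi/2"
    and start: "0 < 2 * cos (\<rho> a) + sin (\<rho> a) * cos (r a)"
    and lim: "((\<lambda>s. cos (r s)) \<longlongrightarrow> -1) at_top" "(\<rho> \<longlongrightarrow> arctan 2) at_top"
  shows "\<exists>s>a. 2 * cos (\<rho> s) + sin (\<rho> s) * cos (r s) = 0"
proof (rule ccontr)
  define w where "w s = 2 * cos (\<rho> s) + sin (\<rho> s) * cos (r s)" for s
  have start': "0 < w a" using start by (simp add: w_def)
  assume "\<not> ?thesis"
  then have nz: "w s \<noteq> 0" if "a < s" for s using that by (auto simp: w_def)
  have w_cont: "continuous_on A w" for A unfolding w_def by (intro continuous_intros)
  have w_pos: "0 < w s" if as: "a \<le> s" for s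
  proof (rule ccontr)
    assume "\<not> 0 < w s"
    then obtain u where "a \<le> u" "u \<le> s" "w u = 0"
      using IVT2'[of w s 0 a] start' as w_cont[of "{a..s}"] by auto
    with nz[of u] start' show False by (cases "u = a") auto
  qed
  define q where "q s = w s / (1 + cos (r s))" for s
  have e_pos: "0 < 1 + cos (r s)" for s
    using cos_monotone_0_pi[of "r s" pi] r[of s] by simp
  have q_pos: "0 < q s" if "a \<le> s" for s
    using w_pos[OF that] e_pos by (simp add: q_def)
  define q' where "q' s = q s * (cos (\<rho> s) - 2 * sin (\<rho> s)) - (1 - cos (r s)) * (sin (\<rho> s) * cos (\<rho> s))" for s
  have q_deriv: "(q has_real_derivative q' s) (at s)" for s
  proof -
    let ?c = "cos (r s)" and ?S = "sin (\<rho> s)" and ?C = "cos (\<rho> s)"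
    have c': "- (sin (r s))\<^sup>2 * ?C = - (1 - ?c) * (1 + ?c) * ?C"
      unfolding sin_squared_eq by (simp add: power2_eq_square algebra_simps)
    have "(w has_real_derivative (?c * ?C - 2 * ?S) * w s + ?S * (- (1 - ?c) * (1 + ?c) * ?C)) (at s)"
    proof -
      have "((\<lambda>s. cos (\<rho> s)) has_real_derivative - ?S * w s) (at s)"
        "((\<lambda>s. sin (\<rho> s)) has_real_derivative ?C * w s) (at s)"
        by (auto intro!: derivative_eq_intros \<rho>_deriv simp: w_def)
      from DERIV_add[OF DERIV_cmult[OF this(1), of 2] DERIV_mult[OF this(2) cos_r_deriv]]
      have "(w has_real_derivative 2 * (- ?S * w s) + (?C * w s * ?c + - (sin (r s))\<^sup>2 * ?C * ?S)) (at s)"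
        by (simp only: w_def[abs_def])
      moreover have "2 * (- ?S * w s) + (?C * w s * ?c + - (sin (r s))\<^sup>2 * ?C * ?S)
          = (?c * ?C - 2 * ?S) * w s + ?S * (- (1 - ?c) * (1 + ?c) * ?C)"
        unfolding c' by algebra
      ultimately show ?thesis by simp
    qed
    moreover have "((\<lambda>s. 1 + cos (r s)) has_real_derivative - (1 - ?c) * (1 + ?c) * ?C) (at s)"
      using DERIV_add[OF DERIV_const[of 1] cos_r_deriv[of s]] unfolding c' by simp
    ultimately have "(q has_real_derivative
        (((?c * ?C - 2 * ?S) * w s + ?S * (- (1 - ?c) * (1 + ?c) * ?C)) * (1 + ?c)
          - w s * (- (1 - ?c) * (1 + ?c) * ?C)) / ((1 + ?c) * (1 + ?c))) (at s)"
      unfolding q_def using e_pos[of s] by (intro DERIV_divide) auto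
    moreover have "(((?c * ?C - 2 * ?S) * w s + ?S * (- (1 - ?c) * (1 + ?c) * ?C)) * (1 + ?c)
          - w s * (- (1 - ?c) * (1 + ?c) * ?C)) / ((1 + ?c) * (1 + ?c)) = q' s"
    proof -
      have w: "w s = q s * (1 + ?c)" using e_pos[of s] by (simp add: q_def)
      have "((?c * ?C - 2 * ?S) * w s + ?S * (- (1 - ?c) * (1 + ?c) * ?C)) * (1 + ?c)
          - w s * (- (1 - ?c) * (1 + ?c) * ?C) = q' s * ((1 + ?c) * (1 + ?c))"
        unfolding w q'_def by algebra
      then show ?thesis using e_pos[of s] by simp
    qed
    ultimately show ?thesis by simp
  qed
  define A :: real where "A = arctan 2"
  have A: "0 < cos A" "sin A = 2 * cos A"
    using tan_arctan[of 2] by (simp_all add: A_def cos_arctan sin_arctan)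
  have "((\<lambda>s. cos (\<rho> s) - 2 * sin (\<rho> s)) \<longlongrightarrow> cos A - 2 * sin A) at_top"
    unfolding A_def by (intro tendsto_intros lim)
  then have "\<forall>\<^sub>F s in at_top. cos (\<rho> s) - 2 * sin (\<rho> s) < 0"
    using A by (auto dest: order_tendstoD(2)[of _ _ _ 0])
  moreover have "((\<lambda>s. (1 - cos (r s)) * (sin (\<rho> s) * cos (\<rho> s))) \<longlongrightarrow> (1 - -1) * (sin A * cos A)) at_top"
    unfolding A_def by (intro tendsto_intros lim)
  then have "\<forall>\<^sub>F s in at_top. sin A * cos A < (1 - cos (r s)) * (sin (\<rho> s) * cos (\<rho> s))"
    using A by (auto dest: order_tendstoD(1)[of _ _ _ "sin A * cos A"])
  moreover have "\<forall>\<^sub>F s in at_top. a \<le> s" by (rule eventually_ge_at_top)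
  ultimately have "\<forall>\<^sub>F s in at_top. sin A * cos A \<le> - q' s"
  proof eventually_elim
    case (elim s)
    then have "q s * (cos (\<rho> s) - 2 * sin (\<rho> s)) \<le> 0"
      using q_pos[of s] by (intro mult_nonneg_nonpos) auto
    with elim show ?case by (simp add: q'_def)
  qed
  then obtain b where "\<And>s. b \<le> s \<Longrightarrow> sin A * cos A \<le> - q' s"
    by (auto simp: eventually_at_top_linorder)
  then have "filterlim (\<lambda>s. - q s) at_top at_top"
    using A by (intro filterlim_at_top_if_deriv_ge[of b _ "\<lambda>s. - q' s" "sin A * cos A"])
      (auto intro!: derivative_eq_intros q_deriv)
  then have "\<forall>\<^sub>F s in at_top. 0 \<le> - q s" by (simp only: filterlim_at_top)
  then obtain b where "\<And>s. b \<le> s \<Longrightarrow> 0 \<le> - q s" by (auto simp: eventually_at_top_linorder)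
  from this[of "max a b"] q_pos[of "max a b"] show False by simp
qed

end

section \<open>Orbits launched from the axis and the separatrix\<close>

text \<open>\<open>\<Lambda>\<close> is the part of the isocline \<open>\<rho>' = 0\<close> with \<open>\<bar>\<rho>\<bar> < pi/2\<close>. On the isocline \<open>r = pi/2\<close> would force \<open>cos \<rho> = 0\<close>.\<close>

lemma Lambda_curveI:
  assumes "r \<in> {0<..<pi}" "- pi/2 < \<rho>" "\<rho> < pi/2" "2 * cos \<rho> + sin \<rho> * cos r = 0"
  shows "(r, \<rho>) \<in> Lambda_curve"
proof -
  have c: "0 < cos \<rho>" using assms by (intro cos_gt_zero_pi) auto
  then have r: "cos r \<noteq> 0" using assms(4) by auto
  have "tan \<rho> = - (2 / cos r)"
    using assms(4) c r by (simp add: tan_def field_simps add_eq_0_iff)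
  moreover have "arctan (tan \<rho>) = \<rho>" using assms by (intro arctan_tan) auto
  ultimately have "\<rho> = - arctan (2 / cos r)" by (simp add: arctan_minus)
  moreover have "r \<noteq> pi/2" using r by (metis cos_pi_half)
  ultimately show ?thesis using assms(1) by (auto simp: Lambda_curve_def)
qed

lemma tendsto_if_tendsto_cos:
  assumes "((\<lambda>s. cos (f s)) \<longlongrightarrow> l) F" and "\<And>s. f s \<in> {0<..<pi}" and "l \<in> {-1..1}"
  shows "(f \<longlongrightarrow> arccos l) F"
proof -
  have "((\<lambda>s. arccos (cos (f s))) \<longlongrightarrow> arccos l) F"
    using continuous_on_arccos' assms(1,3) by (rule continuous_on_tendsto_compose) simp
  moreover have "arccos (cos (f s)) = f s" for s
    using assms(2)[of s] by (intro arccos_cos) auto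
  ultimately show ?thesis by simp
qed

context grim_orbit
begin

lemma orbit_has_vector_derivative: "((\<lambda>s. (r s, \<rho> s)) has_vector_derivative grim_field (r s, \<rho> s)) (at s)"
  unfolding grim_field_def using r_deriv[of s] \<rho>_deriv[of s]
  by (auto intro: has_vector_derivative_Pair simp: has_real_derivative_iff_has_vector_derivative)

text \<open>On the line \<open>r = pi/2\<close> below the saddle the field points to the right.\<close>

lemma lower_right_strict:
  assumes "0 \<le> \<rho> a" "\<rho> a < pi/2" "cos (r a) \<le> 0" "a < s"
  shows "cos (r s) < 0"
proof -
  have "0 < - cos (r s)"
  proof (rule positive_after_upcrossing[where f = "\<lambda>s. - cos (r s)" and a = a and b = s])
    fix u assume u: "a \<le> u"
    show "((\<lambda>s. - cos (r s)) has_real_derivative (sin (r u))\<^sup>2 * cos (\<rho> u)) (at u)"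
      using DERIV_minus[OF cos_r_deriv, of u] by simp
    assume "- cos (r u) = 0"
    then have "(sin (r u))\<^sup>2 = 1" by (simp add: sin_squared_eq)
    moreover have "0 \<le> \<rho> u" using \<rho>_pos[of a u] u assms by (cases "a = u") auto
    then have "0 < cos (\<rho> u)"
      using lower_right_invariant(1)[OF assms(1-3) u] by (intro cos_gt_zero_pi) auto
    ultimately show "0 < (sin (r u))\<^sup>2 * cos (\<rho> u)" by simp
  qed (use assms in auto)
  then show ?thesis by simp
qed

end

locale launched_orbit = grim_orbit +
  fixes x :: real
  assumes start: "r 0 = x" "\<rho> 0 = 0"
begin

lemma \<rho>_in_0_pi: "0 \<le> s \<Longrightarrow> \<rho> s \<in> {0..<pi}"
  using \<rho>_pos[of 0 s] \<rho>_less_pi[of 0 s] start by (cases "s = 0") auto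

lemma \<rho>_positive: "0 < s \<Longrightarrow> 0 < \<rho> s"
  using \<rho>_pos[of 0 s] start by simp

lemma reflect_launched: "launched_orbit (\<lambda>s. pi - r (- s)) (\<lambda>s. - \<rho> (- s)) (pi - x)"
  by (intro launched_orbit.intro reflect launched_orbit_axioms.intro) (simp_all add: start)

lemma right_limits:
  assumes x: "x \<in> {0<..<pi}" and \<rho>: "\<And>s. 0 \<le> s \<Longrightarrow> \<rho> s < pi/2" and b: "0 \<le> b" "cos (r b) < 0"
  shows "(r \<longlongrightarrow> pi) at_top" and "(\<rho> \<longlongrightarrow> arctan 2) at_top"
    and "\<exists>s>0. (r s, \<rho> s) \<in> Lambda_curve"
proof -
  have range: "r s \<in> {0<..<pi}" for s using r_range x start by simp
  have \<rho>0: "0 \<le> \<rho> s \<and> \<rho> s < pi/2" if "0 \<le> s" for s using \<rho> \<rho>_in_0_pi that by auto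
  have lim: "((\<lambda>s. cos (r s)) \<longlongrightarrow> -1) at_top" "(\<rho> \<longlongrightarrow> arctan 2) at_top"
    using lower_right_limits[of b] \<rho>0 b by auto
  show "(\<rho> \<longlongrightarrow> arctan 2) at_top" by fact
  show "(r \<longlongrightarrow> pi) at_top" using tendsto_if_tendsto_cos[OF lim(1) range] by simp
  obtain s where s: "0 < s" "2 * cos (\<rho> s) + sin (\<rho> s) * cos (r s) = 0"
    using \<rho>_stationary[of 0] range \<rho>0 lim start by auto
  then show "\<exists>s>0. (r s, \<rho> s) \<in> Lambda_curve"
    using \<rho>0[of s] by (intro exI[of _ s] conjI Lambda_curveI range) auto
qed

lemma right_half:
  assumes x: "x \<in> {pi/2..<pi}"
  shows "\<And>s. 0 \<le> s \<Longrightarrow> \<rho> s < pi/2" and "\<And>s. 0 < s \<Longrightarrow> cos (r s) < 0"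
    and "(r \<longlongrightarrow> pi) at_top" and "(\<rho> \<longlongrightarrow> arctan 2) at_top"
    and "\<exists>s>0. (r s, \<rho> s) \<in> Lambda_curve"
proof -
  have c: "cos (r 0) \<le> 0"
    using cos_monotone_0_pi_le[of "pi/2" x] x start by auto
  show \<rho>: "\<rho> s < pi/2" if "0 \<le> s" for s
    using lower_right_invariant(1)[of 0 s] start c that by auto
  show neg: "cos (r s) < 0" if "0 < s" for s
    using lower_right_strict[of 0 s] start c that by auto
  show "(r \<longlongrightarrow> pi) at_top" "(\<rho> \<longlongrightarrow> arctan 2) at_top" "\<exists>s>0. (r s, \<rho> s) \<in> Lambda_curve"
    using right_limits[of 1] \<rho> neg[of 1] x by auto
qed

text \<open>The past of an orbit launched at \<open>x\<close> is the reflected future of the orbit launched at \<open>pi - x\<close>.\<close>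

lemma left_half:
  assumes x: "x \<in> {0<..pi/2}"
  shows "\<And>s. s < 0 \<Longrightarrow> -pi/2 < \<rho> s \<and> \<rho> s < 0"
    and "(r \<longlongrightarrow> 0) at_bot" and "(\<rho> \<longlongrightarrow> - arctan 2) at_bot"
    and "\<exists>s<0. (r s, \<rho> s) \<in> Lambda_curve"
proof -
  interpret R: launched_orbit "\<lambda>s. pi - r (- s)" "\<lambda>s. - \<rho> (- s)" "pi - x" by (rule reflect_launched)
  have x': "pi - x \<in> {pi/2..<pi}" using x by auto
  note R = R.right_half[OF x']
  show \<rho>: "-pi/2 < \<rho> s \<and> \<rho> s < 0" if "s < 0" for s
    using R(1)[of "- s"] R.\<rho>_positive[of "- s"] that by simp
  have "((\<lambda>s. pi - (pi - r (- s))) \<longlongrightarrow> pi - pi) at_top"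
    by (intro tendsto_intros R)
  then show "(r \<longlongrightarrow> 0) at_bot" by (simp add: filterlim_at_bot_mirror)
  have "((\<lambda>s. - (- \<rho> (- s))) \<longlongrightarrow> - arctan 2) at_top"
    by (intro tendsto_intros R)
  then show "(\<rho> \<longlongrightarrow> - arctan 2) at_bot" by (simp add: filterlim_at_bot_mirror)
  obtain s where s: "0 < s" "(pi - r (- s), - \<rho> (- s)) \<in> Lambda_curve"
    using R(5) by blast
  then have "(r (- s), \<rho> (- s)) \<in> Lambda_curve"
    by (auto simp: Lambda_curve_def arctan_minus) 
  then show "\<exists>s<0. (r s, \<rho> s) \<in> Lambda_curve" using s(1) by (intro exI[of _ "- s"]) auto
qed

end

lemma grim_orbitI:
  assumes "\<And>s. (\<phi> has_vector_derivative grim_field (\<phi> s)) (at s)"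
  shows "grim_orbit (\<lambda>s. fst (\<phi> s)) (\<lambda>s. snd (\<phi> s))"
proof
  fix s
  show "((\<lambda>s. fst (\<phi> s)) has_real_derivative sin (fst (\<phi> s)) * cos (snd (\<phi> s))) (at s)"
    using bounded_linear.has_vector_derivative[OF bounded_linear_fst assms[of s]]
    by (simp add: has_real_derivative_iff_has_vector_derivative grim_field_def case_prod_beta)
  show "((\<lambda>s. snd (\<phi> s)) has_real_derivative
      2 * cos (snd (\<phi> s)) + sin (snd (\<phi> s)) * cos (fst (\<phi> s))) (at s)"
    using bounded_linear.has_vector_derivative[OF bounded_linear_snd assms[of s]]
    by (simp add: has_real_derivative_iff_has_vector_derivative grim_field_def case_prod_beta)
qed

lemma launched_orbit_exists: "\<exists>r \<rho>. launched_orbit r \<rho> x"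
proof -
  obtain \<phi> where "\<phi> 0 = (x, 0)" "\<And>s. (\<phi> has_vector_derivative grim_field (\<phi> s)) (at s)"
    using lipschitz_ode_global[OF lipschitz_grim_field, of "(x, 0)"] by blast
  then have "launched_orbit (\<lambda>s. fst (\<phi> s)) (\<lambda>s. snd (\<phi> s)) x"
    by (intro launched_orbit.intro grim_orbitI launched_orbit_axioms.intro) auto
  then show ?thesis by blast
qed

lemma launched_orbit_unique:
  assumes "launched_orbit r1 \<rho>1 x" "launched_orbit r2 \<rho>2 x"
  shows "r1 s = r2 s" "\<rho>1 s = \<rho>2 s"
proof -
  interpret O1: launched_orbit r1 \<rho>1 x by fact
  interpret O2: launched_orbit r2 \<rho>2 x by fact
  have "(r1 s, \<rho>1 s) = (r2 s, \<rho>2 s)"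
    by (rule lipschitz_ode_unique[OF lipschitz_grim_field is_interval_univ])
      (auto intro: O1.orbit_has_vector_derivative O2.orbit_has_vector_derivative simp: O1.start O2.start)
  then show "r1 s = r2 s" "\<rho>1 s = \<rho>2 s" by auto
qed

lemma launched_orbit_continuous:
  assumes orbit: "\<And>x. launched_orbit (R x) (P x) x" and "0 \<le> s"
  shows "continuous_on A (\<lambda>x. R x s)" "continuous_on A (\<lambda>x. P x s)"
proof -
  have "dist (R x s, P x s) (R y s, P y s) \<le> exp (6 * s) * dist x y" for x y
  proof -
    interpret O1: launched_orbit "R x" "P x" x by (rule orbit)
    interpret O2: launched_orbit "R y" "P y" y by (rule orbit)
    show ?thesis
      using lipschitz_ode_dist_le[OF lipschitz_grim_field _ _ \<open>0 \<le> s\<close>,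
          of "\<lambda>s. (R x s, P x s)" "\<lambda>s. (R y s, P y s)"]
        O1.orbit_has_vector_derivative O2.orbit_has_vector_derivative
      by (simp add: O1.start O2.start dist_Pair_Pair)
  qed
  then have "(exp (6 * s))-lipschitz_on A (\<lambda>x. (R x s, P x s))"
    by (intro lipschitz_onI) auto
  then have cont: "continuous_on A (\<lambda>x. (R x s, P x s))" by (rule lipschitz_on_continuous_on)
  show "continuous_on A (\<lambda>x. R x s)" "continuous_on A (\<lambda>x. P x s)"
    using continuous_on_fst[OF cont] continuous_on_snd[OF cont] by simp_all
qed

text \<open>The cooperative structure in the strip \<open>0 \<le> \<rho> \<le> pi\<close>. A larger \<open>\<rho>\<close> means a smaller \<open>cos \<rho>\<close>, hence a larger \<open>c'\<close>
  with \<open>c = cos r\<close>; a larger \<open>c\<close> means a larger \<open>\<rho>'\<close> because \<open>sin \<rho> \<ge> 0\<close>. The orbits start at the same height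
  \<open>\<rho> = 0\<close>, so only the first coordinate is ordered strictly at the beginning.\<close>

lemma launched_orbit_comparison:
  assumes "launched_orbit r1 \<rho>1 x" "launched_orbit r2 \<rho>2 y" and xy: "cos y < cos x" and s: "0 \<le> s"
  shows "cos (r2 s) < cos (r1 s)" and "\<rho>2 s \<le> \<rho>1 s"
proof -
  interpret O1: launched_orbit r1 \<rho>1 x by fact
  interpret O2: launched_orbit r2 \<rho>2 y by fact
  let ?f = "\<lambda>s. cos (r1 s) - cos (r2 s)" and ?g = "\<lambda>s. \<rho>1 s - \<rho>2 s"
  let ?f' = "\<lambda>s. - (sin (r1 s))\<^sup>2 * cos (\<rho>1 s) - - (sin (r2 s))\<^sup>2 * cos (\<rho>2 s)"
  let ?g' = "\<lambda>s. (2 * cos (\<rho>1 s) + sin (\<rho>1 s) * cos (r1 s)) - (2 * cos (\<rho>2 s) + sin (\<rho>2 s) * cos (r2 s))"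
  have f_bound: "- 3 * \<bar>?f s\<bar> \<le> ?f' s" if "0 \<le> s" "0 \<le> ?g s" for s
  proof -
    have "cos (\<rho>1 s) \<le> cos (\<rho>2 s)"
      using O1.\<rho>_in_0_pi[OF that(1)] O2.\<rho>_in_0_pi[OF that(1)] that(2) by (intro cos_monotone_0_pi_le) auto
    then have "0 \<le> (sin (r1 s))\<^sup>2 * (cos (\<rho>2 s) - cos (\<rho>1 s))" by simp
    moreover have "?f' s = (sin (r1 s))\<^sup>2 * (cos (\<rho>2 s) - cos (\<rho>1 s))
        + ?f s * ((cos (r1 s) + cos (r2 s)) * cos (\<rho>2 s))"
      unfolding sin_squared_eq by algebra
    moreover have "\<bar>?f s * ((cos (r1 s) + cos (r2 s)) * cos (\<rho>2 s))\<bar> \<le> \<bar>?f s\<bar> * ((1 + 1) * 1)"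
      unfolding abs_mult
      by (intro mult_mono mult_nonneg_nonneg order_trans[OF abs_triangle_ineq] add_mono) auto
    then have "\<bar>?f s * ((cos (r1 s) + cos (r2 s)) * cos (\<rho>2 s))\<bar> \<le> 2 * \<bar>?f s\<bar>" by simp
    ultimately show ?thesis by linarith
  qed
  have g_bound: "- 3 * \<bar>?g s\<bar> \<le> ?g' s" if "0 \<le> s" "0 \<le> ?f s" for s
  proof -
    have "0 \<le> sin (\<rho>1 s) * ?f s"
      using O1.\<rho>_in_0_pi[OF that(1)] that(2) by (intro mult_nonneg_nonneg sin_ge_zero) auto
    moreover have "\<bar>cos (r2 s) * (sin (\<rho>1 s) - sin (\<rho>2 s))\<bar> \<le> 1 * \<bar>?g s\<bar>"
      unfolding abs_mult by (intro mult_mono abs_sin_diff_le) auto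
    then have "- \<bar>?g s\<bar> \<le> cos (r2 s) * (sin (\<rho>1 s) - sin (\<rho>2 s))"
      unfolding mult_1 by (rule minus_le_iff[THEN iffD1, OF abs_le_D2])
    moreover have "- \<bar>?g s\<bar> \<le> cos (\<rho>1 s) - cos (\<rho>2 s)"
      using abs_cos_diff_le[of "\<rho>1 s" "\<rho>2 s"] by linarith
    ultimately have "2 * - \<bar>?g s\<bar> + - \<bar>?g s\<bar> + 0
        \<le> 2 * (cos (\<rho>1 s) - cos (\<rho>2 s)) + cos (r2 s) * (sin (\<rho>1 s) - sin (\<rho>2 s)) + sin (\<rho>1 s) * ?f s"
      by (intro add_mono mult_left_mono) auto
    also have "\<dots> = ?g' s" by algebra
    finally show ?thesis by simp
  qed
  have f: "(?f has_real_derivative ?f' s) (at s)" and g: "(?g has_real_derivative ?g' s) (at s)" for s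
    by (intro DERIV_diff O1.cos_r_deriv O2.cos_r_deriv O1.\<rho>_deriv O2.\<rho>_deriv)+
  have "0 < ?f 0" "0 \<le> ?g 0" using xy by (simp_all add: O1.start O2.start)
  note coop = cooperative_pair[where a = 0 and L = 3, OF f g this f_bound g_bound _ s]
  show "cos (r2 s) < cos (r1 s)" "\<rho>2 s \<le> \<rho>1 s" using coop by auto
qed

text \<open>If the orbit farther to the right stays to the lower left of the saddle, the Lipschitz term in the
  comparison of the first coordinates has the favourable sign, and the gap cannot close. In particular the
  two orbits cannot both converge to the saddle.\<close>

lemma lower_left_gap_nondecreasing:
  assumes "launched_orbit r1 \<rho>1 x" "launched_orbit r2 \<rho>2 y" and xy: "cos y < cos x" and s: "0 \<le> s"
    and lower_left: "\<And>s. 0 \<le> s \<Longrightarrow> 0 < cos (r2 s) \<and> \<rho>2 s < pi/2"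
  shows "cos x - cos y \<le> cos (r1 s) - cos (r2 s)"
proof -
  interpret O1: launched_orbit r1 \<rho>1 x by fact
  interpret O2: launched_orbit r2 \<rho>2 y by fact
  have "cos (r1 0) - cos (r2 0) \<le> cos (r1 s) - cos (r2 s)"
  proof (rule DERIV_nonneg_imp_nondecreasing[OF s, of "\<lambda>s. cos (r1 s) - cos (r2 s)"])
    fix u :: real assume u: "0 \<le> u"
    note compare = launched_orbit_comparison[OF assms(1,2) xy u]
    have "cos (\<rho>1 u) \<le> cos (\<rho>2 u)"
      using O1.\<rho>_in_0_pi[OF u] O2.\<rho>_in_0_pi[OF u] compare by (intro cos_monotone_0_pi_le) auto
    moreover have "0 \<le> cos (\<rho>2 u)"
      using lower_left[OF u] O2.\<rho>_in_0_pi[OF u] by (intro cos_ge_zero) auto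
    ultimately have "0 \<le> (sin (r1 u))\<^sup>2 * (cos (\<rho>2 u) - cos (\<rho>1 u))
        + (cos (r1 u) - cos (r2 u)) * ((cos (r1 u) + cos (r2 u)) * cos (\<rho>2 u))"
      using lower_left[OF u] compare by (intro add_nonneg_nonneg mult_nonneg_nonneg) auto
    also have "\<dots> = - (sin (r1 u))\<^sup>2 * cos (\<rho>1 u) - - (sin (r2 u))\<^sup>2 * cos (\<rho>2 u)"
      unfolding sin_squared_eq by algebra
    finally show "\<exists>d. ((\<lambda>s. cos (r1 s) - cos (r2 s)) has_real_derivative d) (at u) \<and> 0 \<le> d"
      using DERIV_diff[OF O1.cos_r_deriv O2.cos_r_deriv] by blast
  qed
  then show ?thesis by (simp add: O1.start O2.start)
qed

context launched_orbit
begin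

text \<open>To the lower left of the saddle both coordinates are monotone, hence convergent, and \<open>\<rho>'\<close> must tend to \<open>0\<close>.
  There \<open>\<rho>'\<close> is a sum of two nonnegative terms; so both of them tend to \<open>0\<close>, and the only possible limit is
  the saddle.\<close>

lemma saddle_limits:
  assumes x: "x \<in> {0<..<pi}" and lower_left: "\<And>s. 0 \<le> s \<Longrightarrow> 0 < cos (r s) \<and> \<rho> s < pi/2"
  shows "((\<lambda>s. cos (r s)) \<longlongrightarrow> 0) at_top" and "(\<rho> \<longlongrightarrow> pi/2) at_top" and "(r \<longlongrightarrow> pi/2) at_top"
proof -
  have sc: "0 \<le> cos (\<rho> s)" "0 \<le> sin (\<rho> s)" if "0 \<le> s" for s
    using lower_left[OF that] \<rho>_in_0_pi[OF that] by (auto intro!: cos_ge_zero sin_ge_zero)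
  obtain l where l: "((\<lambda>s. - cos (r s)) \<longlongrightarrow> l) at_top" "l \<le> 0"
    using tendsto_at_top_if_nondecreasing[of 0 "\<lambda>s. - cos (r s)" 0] lower_left sc cos_r_decreasing
    by (force intro: less_imp_le)
  have "\<rho> s \<le> \<rho> t" if "0 \<le> s" "s \<le> t" for s t
  proof (rule DERIV_nonneg_imp_nondecreasing[OF that(2)])
    fix u assume "s \<le> u"
    then have "0 \<le> 2 * cos (\<rho> u) + sin (\<rho> u) * cos (r u)"
      using that(1) sc[of u] lower_left[of u] by (intro add_nonneg_nonneg mult_nonneg_nonneg) auto
    with \<rho>_deriv show "\<exists>d. (\<rho> has_real_derivative d) (at u) \<and> 0 \<le> d" by blast
  qed
  then obtain m where m: "(\<rho> \<longlongrightarrow> m) at_top" "\<rho> 0 \<le> m" "m \<le> pi/2"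
    using tendsto_at_top_if_nondecreasing[of 0 \<rho> "pi/2"] lower_left by (force intro: less_imp_le)
  have c: "((\<lambda>s. cos (r s)) \<longlongrightarrow> - l) at_top" using tendsto_minus[OF l(1)] by simp
  have "((\<lambda>s. 2 * cos (\<rho> s) + sin (\<rho> s) * cos (r s)) \<longlongrightarrow> 2 * cos m + sin m * - l) at_top"
    by (intro tendsto_intros c m)
  from deriv_limit_eq_0[OF \<rho>_deriv m(1) this] have eq: "2 * cos m + sin m * - l = 0" .
  have "0 \<le> sin m * - l" using m start l by (intro mult_nonneg_nonneg sin_ge_zero) auto
  moreover have "0 \<le> cos m" using m start by (intro cos_ge_zero) auto
  ultimately have cm: "cos m = 0" using eq by linarith
  have [simp]: "m = pi/2"
  proof (rule ccontr)
    assume "m \<noteq> pi/2"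
    then have "0 < cos m" using m start by (intro cos_gt_zero_pi) auto
    with cm show False by simp
  qed
  with eq have [simp]: "l = 0" by simp
  show "(\<rho> \<longlongrightarrow> pi/2) at_top" using m by simp
  show "((\<lambda>s. cos (r s)) \<longlongrightarrow> 0) at_top" using c by simp
  then show "(r \<longlongrightarrow> pi/2) at_top"
    using tendsto_if_tendsto_cos[of r 0 at_top] r_range x start by simp
qed

text \<open>An orbit that leaves the lower left quadrant through an open side enters the lower right or the upper
  left quadrant at once. The corner is a rest point and cannot be reached: the sum
  \<open>h = cos r + (pi/2 - \<rho>)\<close> satisfies \<open>h' \<ge> - 3 \<bar>h\<bar>\<close> on this orbit.\<close>

lemma lower_left_forever:
  assumes x: "x \<in> {0<..<pi/2}"
    and no_right: "\<And>s. 0 \<le> s \<Longrightarrow> \<not> (cos (r s) < 0 \<and> \<rho> s < pi/2)"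
    and no_left: "\<And>s. 0 \<le> s \<Longrightarrow> \<not> (0 < cos (r s) \<and> pi/2 < \<rho> s)"
    and s: "0 \<le> s"
  shows "0 < cos (r s) \<and> \<rho> s < pi/2"
proof -
  \<comment> \<open>On the side r = pi/2, or beyond it, the orbit would be to the lower right a unit of time later.\<close>
  have no_right': "\<not> (cos (r s) \<le> 0 \<and> \<rho> s < pi/2)" if "0 \<le> s" for s
  proof
    assume *: "cos (r s) \<le> 0 \<and> \<rho> s < pi/2"
    have "cos (r (s + 1)) < 0" "\<rho> (s + 1) < pi/2"
      using lower_right_strict[of s "s + 1"] lower_right_invariant(1)[of s "s + 1"] * \<rho>_in_0_pi[OF that] by auto
    with no_right[of "s + 1"] that show False by simp
  qed
  \<comment> \<open>On the side \<rho> = pi/2 the derivative of \<rho> is cos r > 0, so just afterwards the orbit would be to the upper left.\<close>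
  have no_left': "\<not> (0 < cos (r s) \<and> pi/2 \<le> \<rho> s)" if "0 \<le> s" for s
  proof
    assume *: "0 < cos (r s) \<and> pi/2 \<le> \<rho> s"
    then have "\<rho> s = pi/2" using no_left[OF that] by auto
    have "isCont (\<lambda>s. cos (r s)) s" using cos_r_deriv by (rule DERIV_isCont)
    then have "\<forall>\<^sub>F u in at s. 0 < cos (r u)"
      using * by (auto simp: isCont_def dest: order_tendstoD(1)[of _ _ _ 0])
    then have "\<forall>\<^sub>F u in at_right s. 0 < cos (r u)"
      by (simp add: eventually_at_split)
    moreover obtain d where "0 < d" "\<And>h. 0 < h \<Longrightarrow> h < d \<Longrightarrow> \<rho> s < \<rho> (s + h)"
      using DERIV_pos_inc_right[OF \<rho>_deriv[of s]] \<open>\<rho> s = pi/2\<close> * by auto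
    then have "\<forall>\<^sub>F u in at_right s. pi/2 < \<rho> u"
      unfolding eventually_at_right_field \<open>\<rho> s = pi/2\<close>[symmetric]
      by (intro exI[of _ "s + d"]) (metis add.commute add_diff_cancel_left' diff_add_cancel diff_gt_0_iff_gt diff_less_eq less_add_same_cancel1)
    moreover have "\<forall>\<^sub>F u in at_right s. s < u" by (simp add: eventually_at_right_less)
    ultimately have "\<forall>\<^sub>F u in at_right s. 0 < cos (r u) \<and> pi/2 < \<rho> u \<and> s < u"
      by eventually_elim auto
    then obtain u where "0 < cos (r u)" "pi/2 < \<rho> u" "s < u"
      using eventually_happens'[OF trivial_limit_at_right_real] by blast
    with no_left[of u] that show False by simp
  qed
  define h where "h s = cos (r s) + (pi/2 - \<rho> s)" for s
  have "0 < h s"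
  proof (rule positive_if_deriv_ge_neg_abs[where f = h and a = 0 and b = s and L = 3])
    fix u :: real assume u: "0 \<le> u"
    let ?h' = "- (sin (r u))\<^sup>2 * cos (\<rho> u) + (0 - (2 * cos (\<rho> u) + sin (\<rho> u) * cos (r u)))"
    show "(h has_real_derivative ?h') (at u)"
      unfolding h_def by (intro DERIV_add DERIV_diff cos_r_deriv \<rho>_deriv DERIV_const)
    have S: "0 \<le> sin (\<rho> u)" "sin (\<rho> u) \<le> 1" using \<rho>_in_0_pi[OF u] by (auto intro!: sin_ge_zero)
    have sq: "0 \<le> (sin (r u))\<^sup>2" "(sin (r u))\<^sup>2 \<le> 1" by (auto simp: abs_square_le_1)
    show "- 3 * \<bar>h u\<bar> \<le> ?h'"
    \<comment> \<open>Off the quadrant both summands of h are nonpositive and h does not decrease; inside it cos \<rho> \<le> pi/2 - \<rho> limits the loss to 3 h.\<close>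
    proof (cases "cos (r u) \<le> 0")
      case True
      with no_right'[OF u] have "pi/2 \<le> \<rho> u" by auto
      then have C: "cos (\<rho> u) \<le> 0"
        using cos_monotone_0_pi_le[of "pi/2" "\<rho> u"] \<rho>_in_0_pi[OF u] by auto
      have "(sin (r u))\<^sup>2 * cos (\<rho> u) \<le> 0" "sin (\<rho> u) * cos (r u) \<le> 0"
        using sq S C True by (auto intro!: mult_nonneg_nonpos)
      with C show ?thesis by auto
    next
      case False
      with no_left'[OF u] have \<rho>: "\<rho> u < pi/2" by auto
      have "cos (\<rho> u) = sin (pi/2 - \<rho> u)" by (simp add: sin_diff)
      also have "\<dots> \<le> pi/2 - \<rho> u" using \<rho> by (intro sin_x_le_x) auto
      finally have C: "cos (\<rho> u) \<le> pi/2 - \<rho> u" .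
      have C0: "0 \<le> cos (\<rho> u)" using \<rho> \<rho>_in_0_pi[OF u] by (intro cos_ge_zero) auto
      have "(sin (r u))\<^sup>2 * cos (\<rho> u) \<le> 1 * cos (\<rho> u)"
        using sq(2) C0 by (rule mult_right_mono)
      moreover have "sin (\<rho> u) * cos (r u) \<le> 1 * cos (r u)"
        using S(2) by (rule mult_right_mono) (use False in simp)
      ultimately have "(sin (r u))\<^sup>2 * cos (\<rho> u) + (2 * cos (\<rho> u) + sin (\<rho> u) * cos (r u))
          \<le> (pi/2 - \<rho> u) + (2 * (pi/2 - \<rho> u) + cos (r u))"
        unfolding mult_1 using C by (intro add_mono mult_left_mono) auto
      also have "\<dots> \<le> 3 * h u" using False by (simp add: h_def)
      also have "\<dots> = 3 * \<bar>h u\<bar>" using False \<rho> by (simp add: h_def)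
      finally have "- (3 * \<bar>h u\<bar>) \<le> - ((sin (r u))\<^sup>2 * cos (\<rho> u) + (2 * cos (\<rho> u) + sin (\<rho> u) * cos (r u)))"
        by (simp only: neg_le_iff_le)
      then show ?thesis by (simp only: mult_minus_left minus_add_distrib diff_0)
    qed
  next
    show "0 < h 0" using x start cos_gt_zero_pi[of x] by (simp add: h_def add_pos_pos)
  qed (use s in auto)
  then have "0 < cos (r s) \<or> \<rho> s < pi/2" by (auto simp: h_def)
  then show ?thesis using no_left'[OF s] no_right'[OF s] by auto
qed

end

text \<open>The sets \<open>A\<close> and \<open>B\<close> of launch points whose orbits enter the lower right and the upper left quadrant are
  open by continuous dependence, and disjoint because both quadrants are invariant; for the second one this
  is the half turn of the first. The point \<open>0\<close> is useful although it is not in the phase plane: its orbit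
  runs up the line \<open>r = 0\<close> with \<open>\<rho>' \<ge> 1\<close> as long as \<open>\<rho> \<le> pi/2\<close>.\<close>

lemma separatrix_exists:
  "\<exists>x\<in>{0<..<pi/2}. \<forall>r \<rho>. launched_orbit r \<rho> x \<longrightarrow> (\<forall>s\<ge>0. 0 < cos (r s) \<and> \<rho> s < pi/2)"
proof -
  obtain R P where RP: "\<And>x. launched_orbit (R x) (P x) x"
    using launched_orbit_exists by metis
  define A where "A = (\<Union>s\<in>{0..}. {x. cos (R x s) < 0} \<inter> {x. P x s < pi/2})"
  define B where "B = (\<Union>s\<in>{0..}. {x. 0 < cos (R x s)} \<inter> {x. pi/2 < P x s})"
  have "open A" "open B"
    unfolding A_def B_def
    by (auto intro!: open_UN open_Int open_Collect_less continuous_intros launched_orbit_continuous[OF RP])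
  moreover have "connected {0..pi/2}" by simp
  moreover have "A \<inter> B \<inter> {0..pi/2} = {}"
  proof -
    have False if "x \<in> A" "x \<in> B" for x
    proof -
      interpret launched_orbit "R x" "P x" x by (rule RP)
      interpret R: grim_orbit "\<lambda>s. pi - R x s" "\<lambda>s. pi - P x s" by (rule rotate)
      obtain a where a: "0 \<le> a" "cos (R x a) < 0" "P x a < pi/2" using \<open>x \<in> A\<close> by (auto simp: A_def)
      obtain b where b: "0 \<le> b" "0 < cos (R x b)" "pi/2 < P x b" using \<open>x \<in> B\<close> by (auto simp: B_def)
      show False
      proof (cases "a \<le> b")
        case True
        then show False using lower_right_invariant(1)[of a b] a b \<rho>_in_0_pi[of a] by auto
      next
        case False
        then show False using R.lower_right_invariant(1)[of b a] a b \<rho>_in_0_pi[of b] by auto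
      qed
    qed
    then show ?thesis by auto
  qed
  moreover have "pi/2 \<in> A"
  proof -
    interpret launched_orbit "R (pi/2)" "P (pi/2)" "pi/2" by (rule RP)
    show ?thesis using right_half(1,2)[of 1] by (auto simp: A_def intro!: bexI[of _ 1])
  qed
  moreover have "0 \<in> B"
  proof -
    interpret launched_orbit "R 0" "P 0" 0 by (rule RP)
    have r0: "R 0 s = 0" if "0 \<le> s" for s
    proof -
      have "0 \<le> R 0 s"
        by (rule nonneg_if_deriv_ge_neg_abs[where f = "R 0" and a = 0 and b = s and L = 1, OF r_deriv])
          (use that start sin_mult_cos_ge in auto)
      moreover have "0 \<le> - R 0 s"
      proof (rule nonneg_if_deriv_ge_neg_abs[where f = "\<lambda>s. - R 0 s" and a = 0 and b = s and L = 1])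
        fix u
        show "((\<lambda>s. - R 0 s) has_real_derivative - (sin (R 0 u) * cos (P 0 u))) (at u)"
          by (rule DERIV_minus[OF r_deriv])
        show "- 1 * \<bar>- R 0 u\<bar> \<le> - (sin (R 0 u) * cos (P 0 u))"
          using sin_mult_cos_ge[of "R 0 u" "pi - P 0 u"] by simp
      qed (use that start in auto)
      ultimately show ?thesis by simp
    qed
    have "\<exists>s\<ge>0. pi/2 < P 0 s"
    proof (rule ccontr)
      assume "\<not> ?thesis"
      then have le: "P 0 s \<le> pi/2" if "0 \<le> s" for s using that by force
      have "filterlim (P 0) at_top at_top"
      proof (rule filterlim_at_top_if_deriv_ge[OF \<rho>_deriv])
        fix s :: real assume "0 \<le> s"
        then show "1 \<le> 2 * cos (P 0 s) + sin (P 0 s) * cos (R 0 s)"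
          using sin_plus_cos_ge_1[of "P 0 s"] le[of s] \<rho>_in_0_pi[of s] r0[of s] cos_ge_zero[of "P 0 s"] by auto
      qed simp
      then have "\<forall>\<^sub>F s in at_top. pi \<le> P 0 s" by (simp only: filterlim_at_top)
      then obtain b where "\<And>s. b \<le> s \<Longrightarrow> pi \<le> P 0 s" by (auto simp: eventually_at_top_linorder)
      from this[of "max b 0"] le[of "max b 0"] show False using pi_gt_zero by simp
    qed
    then show ?thesis using r0 by (auto simp: B_def)
  qed
  ultimately have "\<not> {0..pi/2} \<subseteq> A \<union> B"
    using connectedD[of "{0..pi/2}" A B] by (metis IntI atLeastAtMost_iff emptyE order_refl pi_half_ge_zero)
  then obtain x where x: "x \<in> {0..pi/2}" "x \<notin> A" "x \<notin> B" by blast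
  then have "x \<noteq> 0" "x \<noteq> pi/2" using \<open>0 \<in> B\<close> \<open>pi/2 \<in> A\<close> by metis+
  with x have x': "x \<in> {0<..<pi/2}" by auto
  interpret O: launched_orbit "R x" "P x" x by (rule RP)
  have "0 < cos (R x s) \<and> P x s < pi/2" if "0 \<le> s" for s
    by (rule O.lower_left_forever[OF x']) (use x that in \<open>auto simp: A_def B_def\<close>)
  then show ?thesis using x' launched_orbit_unique[OF _ RP] by metis
qed

section \<open>Generating curves and their classification\<close>

lemma image_range_eq_if_reflected:
  fixes g :: "real \<Rightarrow> 'a"
  assumes "\<And>s. F (g s) = g (- s)"
  shows "F ` range g = range g"
proof -
  have "surj (uminus :: real \<Rightarrow> real)" by (rule surjI) (rule minus_minus)
  then have "range (\<lambda>s. g (- s)) = range g" by (metis image_image)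
  then show ?thesis by (simp add: image_image assms)
qed

text \<open>A maximal solution is the restriction of a global orbit. As this orbit stays in the phase plane, the
  restriction is no restriction.\<close>

lemma maximal_solution_launched:
  assumes "maximal_solution (x, 0) T \<gamma>" and x: "x \<in> {0<..pi/2}"
  shows "T = UNIV" and "launched_orbit (\<lambda>s. fst (\<gamma> s)) (\<lambda>s. snd (\<gamma> s)) x"
proof -
  have T: "0 \<in> T" "\<gamma> 0 = (x, 0)" "solution_on T \<gamma>"
    using assms(1) by (auto simp: maximal_solution_def)
  have maximal: "T' = T" if "solution_on T' \<gamma>'" "T \<subseteq> T'" "\<And>s. s \<in> T \<Longrightarrow> \<gamma>' s = \<gamma> s" for T' \<gamma>'
    using assms(1) that unfolding maximal_solution_def by blast
  obtain r \<rho> where "launched_orbit r \<rho> x" using launched_orbit_exists by blast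
  then interpret O: launched_orbit r \<rho> x .
  have "(r s, \<rho> s) \<in> phase_plane" for s
  proof -
    have "r s \<in> {0<..<pi}" using O.r_range x O.start by auto
    moreover have "\<rho> s \<in> {-pi<..<pi}"
      using O.\<rho>_in_0_pi[of s] O.left_half(1)[OF x, of s] pi_gt_zero by (cases "0 \<le> s") auto
    ultimately show ?thesis by (simp add: phase_plane_def)
  qed
  then have global: "solution_on UNIV (\<lambda>s. (r s, \<rho> s))"
    by (auto simp: solution_on_def O.orbit_has_vector_derivative)
  have "(r s, \<rho> s) = \<gamma> s" if "s \<in> T" for s
    by (rule lipschitz_ode_unique[OF lipschitz_grim_field, of T s "\<lambda>s. (r s, \<rho> s)" \<gamma>])
      (use T that O.orbit_has_vector_derivative in \<open>auto simp: solution_on_def O.start\<close>)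
  from maximal[OF global _ this] show "T = UNIV" by simp
  then show "launched_orbit (\<lambda>s. fst (\<gamma> s)) (\<lambda>s. snd (\<gamma> s)) x"
    using T by (intro launched_orbit.intro grim_orbitI launched_orbit_axioms.intro) (auto simp: solution_on_def)
qed

text \<open>By comparison such an orbit stays below \<open>\<rho> = pi/2\<close>. If it did not cross \<open>r = pi/2\<close> it would converge to the saddle
  together with the separatrix, and the gap between them would close.\<close>

lemma right_of_separatrix:
  assumes "launched_orbit r1 \<rho>1 x" and sep: "\<And>s. 0 \<le> s \<Longrightarrow> 0 < cos (r1 s) \<and> \<rho>1 s < pi/2"
    and "launched_orbit r2 \<rho>2 y" and xy: "0 < x" "x < y" "y < pi"
  shows "\<And>s. 0 \<le> s \<Longrightarrow> \<rho>2 s < pi/2" and "\<exists>b\<ge>0. cos (r2 b) < 0"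
proof -
  interpret O1: launched_orbit r1 \<rho>1 x by fact
  interpret O2: launched_orbit r2 \<rho>2 y by fact
  have c: "cos y < cos x" using xy by (intro cos_monotone_0_pi) auto
  show \<rho>2: "\<rho>2 s < pi/2" if "0 \<le> s" for s
    using launched_orbit_comparison(2)[OF assms(1,3) c that] sep[OF that] by simp
  show "\<exists>b\<ge>0. cos (r2 b) < 0"
  proof (rule ccontr)
    assume "\<not> ?thesis"
    then have nonneg: "0 \<le> cos (r2 s)" if "0 \<le> s" for s using that by force
    have lower_left: "0 < cos (r2 s) \<and> \<rho>2 s < pi/2" if "0 \<le> s" for s
      using O2.lower_right_strict[of s "s + 1"] nonneg[of s] nonneg[of "s + 1"] \<rho>2[OF that]
        O2.\<rho>_in_0_pi[OF that] that by force
    have "((\<lambda>s. cos (r1 s) - cos (r2 s)) \<longlongrightarrow> 0 - 0) at_top"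
      using O1.saddle_limits(1) O2.saddle_limits(1) sep lower_left xy by (intro tendsto_diff) auto
    moreover have "\<forall>\<^sub>F s in at_top. cos x - cos y \<le> cos (r1 s) - cos (r2 s)"
      using lower_left_gap_nondecreasing[OF assms(1,3) c _ lower_left]
      by (intro eventually_at_top_linorderI[of 0])
    ultimately have "cos x - cos y \<le> 0 - 0"
      by (rule tendsto_lowerbound) simp
    with c show False by simp
  qed
qed

text \<open>By comparison such an orbit stays in \<open>r < pi/2\<close>. If it did not reach \<open>\<rho> = pi/2\<close> it would converge to the saddle
  together with the separatrix, and the gap between them would close.\<close>

lemma left_of_separatrix:
  assumes "launched_orbit r1 \<rho>1 x" and "launched_orbit r2 \<rho>2 y"
    and sep: "\<And>s. 0 \<le> s \<Longrightarrow> 0 < cos (r2 s) \<and> \<rho>2 s < pi/2" and xy: "0 < x" "x < y" "y < pi"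
  shows "\<And>s. 0 \<le> s \<Longrightarrow> 0 < cos (r1 s)" and "\<exists>b\<ge>0. pi/2 \<le> \<rho>1 b"
proof -
  interpret O1: launched_orbit r1 \<rho>1 x by fact
  interpret O2: launched_orbit r2 \<rho>2 y by fact
  have c: "cos y < cos x" using xy by (intro cos_monotone_0_pi) auto
  show cos1: "0 < cos (r1 s)" if "0 \<le> s" for s
    using launched_orbit_comparison(1)[OF assms(1,2) c that] sep[OF that] by simp
  show "\<exists>b\<ge>0. pi/2 \<le> \<rho>1 b"
  proof (rule ccontr)
    assume "\<not> ?thesis"
    then have \<rho>1: "\<rho>1 s < pi/2" if "0 \<le> s" for s using that by force
    have "((\<lambda>s. cos (r1 s) - cos (r2 s)) \<longlongrightarrow> 0 - 0) at_top"
      using O1.saddle_limits(1) O2.saddle_limits(1) sep cos1 \<rho>1 xy by (intro tendsto_diff) auto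
    moreover have "\<forall>\<^sub>F s in at_top. cos x - cos y \<le> cos (r1 s) - cos (r2 s)"
      using lower_left_gap_nondecreasing[OF assms(1,2) c _ sep]
      by (intro eventually_at_top_linorderI[of 0])
    ultimately have "cos x - cos y \<le> 0 - 0"
      by (rule tendsto_lowerbound) simp
    with c show False by simp
  qed
qed

context launched_orbit
begin

text \<open>For \<open>r < pi/2\<close> the line \<open>\<rho> = pi/2\<close> can only be crossed upwards, since \<open>\<rho>' = cos r\<close> there.\<close>

lemma turning_point:
  assumes cos: "\<And>s. 0 \<le> s \<Longrightarrow> 0 < cos (r s)" and b: "0 \<le> b" "pi/2 \<le> \<rho> b"
  shows "\<exists>s0>0. \<rho> s0 = pi/2 \<and> (\<forall>s\<ge>0. s < s0 \<longrightarrow> \<rho> s < pi/2) \<and> (\<forall>s>s0. pi/2 < \<rho> s)"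
proof -
  have after: "pi/2 < \<rho> t" if "0 \<le> s" "pi/2 \<le> \<rho> s" "s < t" for s t
  proof -
    have "0 < \<rho> t - pi/2"
    proof (rule positive_after_upcrossing[where f = "\<lambda>s. \<rho> s - pi/2" and a = s and b = t])
      fix u assume u: "s \<le> u"
      show "((\<lambda>s. \<rho> s - pi/2) has_real_derivative (2 * cos (\<rho> u) + sin (\<rho> u) * cos (r u)) - 0) (at u)"
        by (intro DERIV_diff \<rho>_deriv DERIV_const)
      assume "\<rho> u - pi/2 = 0"
      then have "\<rho> u = pi/2" by simp
      then show "0 < (2 * cos (\<rho> u) + sin (\<rho> u) * cos (r u)) - 0"
        using cos[of u] u that(1) by (simp only:) simp
    qed (use that in auto)
    then show ?thesis by simp
  qed
  obtain s0 where s0: "0 \<le> s0" "\<rho> s0 = pi/2"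
    using IVT'[of \<rho> 0 "pi/2" b] b start cont(2)[of "{0..b}"] by auto
  then have "s0 \<noteq> 0" using start by auto
  moreover have "\<rho> s < pi/2" if "0 \<le> s" "s < s0" for s
    using after[of s s0] that s0 by force
  ultimately show ?thesis using s0 after[of s0] by (intro exI[of _ s0]) auto
qed

lemma r_strict_increasing:
  assumes "x \<in> {0<..<pi}" and "s < t" and "\<And>u. s \<le> u \<Longrightarrow> u < t \<Longrightarrow> - pi/2 < \<rho> u \<and> \<rho> u < pi/2"
  shows "r s < r t"
proof (rule DERIV_pos_imp_increasing_open[OF \<open>s < t\<close>])
  fix u assume u: "s < u" "u < t"
  have "0 < sin (r u) * cos (\<rho> u)"
    using r_range[of u] assms(1) start assms(3)[of u] u
    by (intro mult_pos_pos sin_gt_zero cos_gt_zero_pi) auto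
  then show "\<exists>d. (r has_real_derivative d) (at u) \<and> 0 < d" using r_deriv by blast
qed (rule cont)

lemma r_strict_decreasing:
  assumes "x \<in> {0<..<pi}" and "0 \<le> s" "s < t" and "\<And>u. s < u \<Longrightarrow> pi/2 < \<rho> u"
  shows "r t < r s"
proof (rule DERIV_neg_imp_decreasing_open[OF \<open>s < t\<close>])
  fix u assume u: "s < u" "u < t"
  have "0 < sin (r u) * cos (pi - \<rho> u)"
    using r_range[of u] assms(1,2) start assms(4)[of u] u \<rho>_in_0_pi[of u]
    by (intro mult_pos_pos sin_gt_zero cos_gt_zero_pi) auto
  then show "\<exists>d. (r has_real_derivative d) (at u) \<and> d < 0" using r_deriv[of u] by force
qed (rule cont)

text \<open>The half turn about the saddle moves this end of the orbit to the lower right quadrant.\<close>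

lemma upper_left_limits:
  assumes x: "x \<in> {0<..<pi}" and a: "0 \<le> a" "0 < cos (r a)" and \<rho>: "\<And>s. a \<le> s \<Longrightarrow> pi/2 < \<rho> s"
  shows "(r \<longlongrightarrow> 0) at_top" and "(\<rho> \<longlongrightarrow> pi - arctan 2) at_top"
proof -
  interpret R: grim_orbit "\<lambda>s. pi - r s" "\<lambda>s. pi - \<rho> s" by (rule rotate)
  have "0 \<le> pi - \<rho> s \<and> pi - \<rho> s < pi/2" if "a \<le> s" for s
    using \<rho>[OF that] \<rho>_in_0_pi[of s] that a by auto
  note lim = R.lower_right_limits[OF this]
  have "((\<lambda>s. pi - r s) \<longlongrightarrow> arccos (- 1)) at_top"
    using lim(1) a r_range x start by (intro tendsto_if_tendsto_cos) auto
  from tendsto_diff[OF tendsto_const[of pi] this] show "(r \<longlongrightarrow> 0) at_top" by simp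
  from tendsto_diff[OF tendsto_const[of pi] lim(2)] a show "(\<rho> \<longlongrightarrow> pi - arctan 2) at_top" by simp
qed

end

text \<open>A launched orbit together with its height function. The orbit is kept as a curve \<open>\<gamma>\<close> in the plane; its
  coordinates are the functions \<open>r\<close> and \<open>\<rho>\<close> of the orbit locales.\<close>

locale generating_curve = launched_orbit "\<lambda>s. fst (\<gamma> s)" "\<lambda>s. snd (\<gamma> s)" x
  for \<gamma> :: "real \<Rightarrow> real \<times> real" and x :: real +
  fixes z :: "real \<Rightarrow> real"
  assumes x: "x \<in> {0<..pi/2}"
    and z_start: "z 0 = 0"
    and z_deriv: "(z has_real_derivative sin (snd (\<gamma> s))) (at s)"
begin

abbreviation "r \<equiv> \<lambda>s. fst (\<gamma> s)"
abbreviation "\<rho> \<equiv> \<lambda>s. snd (\<gamma> s)"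
abbreviation "\<alpha> \<equiv> gen_curve \<gamma> z"

lemma x_pi: "x \<in> {0<..<pi}" using x pi_gt_zero by auto

lemma r_in: "r s \<in> {0<..<pi}" using r_range x_pi start by simp

lemma phase_tendsto: "(r \<longlongrightarrow> a) F \<Longrightarrow> (\<rho> \<longlongrightarrow> b) F \<Longrightarrow> (\<gamma> \<longlongrightarrow> (a, b)) F"
  using tendsto_Pair[of r a F \<rho> b] by simp

lemma left_end:
  shows "\<exists>s<0. \<gamma> s \<in> Lambda_curve" and "(\<gamma> \<longlongrightarrow> (0, - arctan 2)) at_bot"
  using left_half[OF x] phase_tendsto by auto

lemma right_end:
  assumes "\<And>s. 0 \<le> s \<Longrightarrow> \<rho> s < pi/2" "\<exists>b\<ge>0. cos (r b) < 0"
  shows "\<exists>s>0. \<gamma> s \<in> Lambda_curve" and "(\<gamma> \<longlongrightarrow> (pi, arctan 2)) at_top"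
  using right_limits[OF x_pi assms(1)] assms(2) phase_tendsto by auto

lemma height_strict_mono:
  assumes "0 \<le> s" "s < t"
  shows "z s < z t"
proof (rule DERIV_pos_imp_increasing_open[OF \<open>s < t\<close>])
  fix u assume "s < u" "u < t"
  then have "0 < sin (\<rho> u)" using \<rho>_positive[of u] \<rho>_in_0_pi[of u] assms by (intro sin_gt_zero) auto
  then show "\<exists>d. (z has_real_derivative d) (at u) \<and> 0 < d" using z_deriv by blast
qed (auto intro!: continuous_at_imp_continuous_on DERIV_isCont[OF z_deriv])

lemma height_pos:
  assumes "s \<noteq> 0"
  shows "0 < z s"
proof (cases "0 < s")
  case True
  then show ?thesis using height_strict_mono[of 0 s] z_start by simp
next
  case False
  with assms have "s < 0" by simp
  then have "z 0 < z s"
  proof (rule DERIV_neg_imp_decreasing_open)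
    fix u assume "s < u" "u < 0"
    then have "0 < sin (- \<rho> u)"
      using left_half(1)[OF x, of u] pi_gt_zero by (intro sin_gt_zero) auto
    then show "\<exists>d. (z has_real_derivative d) (at u) \<and> d < 0" using z_deriv[of u] by auto
  qed (auto intro!: continuous_at_imp_continuous_on DERIV_isCont[OF z_deriv])
  then show ?thesis using z_start by simp
qed

lemma gen_curve_deriv:
  "(\<alpha> has_vector_derivative (- (sin (r s))\<^sup>2 * cos (\<rho> s), cos (r s) * (sin (r s) * cos (\<rho> s)), sin (\<rho> s))) (at s)"
proof -
  have "((\<lambda>s. sin (r s)) has_real_derivative cos (r s) * (sin (r s) * cos (\<rho> s))) (at s)"
    by (rule DERIV_fun_sin[OF r_deriv])
  with cos_r_deriv[of s] z_deriv[of s] show ?thesis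
    unfolding gen_curve_def has_real_derivative_iff_has_vector_derivative
    by (intro has_vector_derivative_Pair)
qed

text \<open>The horizontal part of the velocity has length \<open>sin r \<bar>cos \<rho>\<bar>\<close>.\<close>

lemma vertical_tangent_iff: "vertical_tangent_at \<alpha> s \<longleftrightarrow> cos (\<rho> s) = 0"
proof
  assume "vertical_tangent_at \<alpha> s"
  then obtain c where "(\<alpha> has_vector_derivative (0, 0, c)) (at s)" by (auto simp: vertical_tangent_at_def)
  from vector_derivative_unique_at[OF this gen_curve_deriv]
  have "(sin (r s))\<^sup>2 * cos (\<rho> s) = 0" by simp
  moreover have "sin (r s) \<noteq> 0" using r_in[of s] sin_gt_zero[of "r s"] by auto
  ultimately show "cos (\<rho> s) = 0" by simp
next
  assume c: "cos (\<rho> s) = 0"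
  then have "sin (\<rho> s) \<noteq> 0" using sin_cos_squared_add[of "\<rho> s"] by auto
  then show "vertical_tangent_at \<alpha> s"
    using gen_curve_deriv[of s] c unfolding vertical_tangent_at_def
    by (intro exI[of _ "sin (\<rho> s)"]) simp
qed

lemma horizontal_tangent_0: "horizontal_tangent_at \<alpha> 0"
proof -
  have "sin (r 0) \<noteq> 0" using r_in[of 0] sin_gt_zero[of "r 0"] by auto
  then show ?thesis
    using gen_curve_deriv[of 0] start unfolding horizontal_tangent_at_def
    by (intro exI[of _ "- (sin (r 0))\<^sup>2"] exI[of _ "cos (r 0) * sin (r 0)"]) auto
qed

text \<open>The point \<open>(cos r, sin r)\<close> of the half circle determines \<open>r\<close>, and an injective \<open>r\<close> determines the time.\<close>

lemma vertical_graph_if_inj: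
  assumes "inj_on r A"
  shows "vertical_graph_on A \<alpha>"
  unfolding vertical_graph_on_def
proof (intro exI ballI)
  fix s assume "s \<in> A"
  have "arccos (cos (r s)) = r s" using r_in[of s] by (intro arccos_cos) auto
  then show "case \<alpha> s of (x, y, h) \<Rightarrow> h = (\<lambda>(x, y). z (the_inv_into A r (arccos x))) (x, y)"
    using the_inv_into_f_f[OF assms \<open>s \<in> A\<close>] by (simp add: gen_curve_def)
qed

lemma \<rho>_gt: "- pi/2 < \<rho> s"
  using left_half(1)[OF x, of s] \<rho>_in_0_pi[of s] pi_gt_zero by (cases "s < 0") auto

lemma vertical_graph_UNIV:
  assumes "\<And>s. 0 \<le> s \<Longrightarrow> \<rho> s < pi/2"
  shows "vertical_graph_on UNIV \<alpha>"
proof (rule vertical_graph_if_inj)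
  have "\<rho> s < pi/2" for s
    using assms[of s] left_half(1)[OF x, of s] pi_gt_zero by (cases "0 \<le> s") auto
  then have "r s < r t" if "s < t" for s t
    using \<rho>_gt that by (intro r_strict_increasing x_pi) auto
  then show "inj_on r UNIV" by (intro linorder_inj_onI) (metis less_irrefl, auto)
qed

lemma gen_curve_touches_plane:
  shows "range \<alpha> \<subseteq> {(x, y, h). y > 0 \<and> h \<ge> 0}"
    and "snd (snd (\<alpha> s)) = 0 \<longleftrightarrow> s = 0"
proof -
  have nonneg: "0 \<le> z s" for s using height_pos[of s] z_start by (cases "s = 0") auto
  have "0 < sin (r s)" for s using r_in[of s] by (intro sin_gt_zero) auto
  with nonneg show "range \<alpha> \<subseteq> {(x, y, h). y > 0 \<and> h \<ge> 0}" by (auto simp: gen_curve_def)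
  show "snd (snd (\<alpha> s)) = 0 \<longleftrightarrow> s = 0"
    using height_pos[of s] z_start by (cases "s = 0") (simp_all add: gen_curve_def)
qed

lemma saddle_curve:
  assumes sep: "\<And>s. 0 \<le> s \<Longrightarrow> 0 < cos (r s) \<and> \<rho> s < pi/2"
  shows "(\<gamma> \<longlongrightarrow> (pi/2, pi/2)) at_top" and "((\<lambda>s. fst (\<gamma> s)) \<longlongrightarrow> pi/2) at_top"
    and "filterlim z at_top at_top"
    and "((\<lambda>s. infdist (\<alpha> s) {(0, 1, h) | h. True}) \<longlongrightarrow> 0) at_top"
proof -
  note lim = saddle_limits[OF x_pi sep]
  show "(\<gamma> \<longlongrightarrow> (pi/2, pi/2)) at_top" using lim phase_tendsto by auto
  show r: "(r \<longlongrightarrow> pi/2) at_top" by (rule lim)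
  have "((\<lambda>s. sin (\<rho> s)) \<longlongrightarrow> sin (pi/2)) at_top" by (intro tendsto_intros lim)
  then have "\<forall>\<^sub>F s in at_top. 1/2 < sin (\<rho> s)" by (intro order_tendstoD(1)) auto
  then obtain b where "\<And>s. b \<le> s \<Longrightarrow> 1/2 < sin (\<rho> s)" by (auto simp: eventually_at_top_linorder)
  then show "filterlim z at_top at_top"
    by (intro filterlim_at_top_if_deriv_ge[of b z "\<lambda>s. sin (\<rho> s)" "1/2"] z_deriv) (auto intro: less_imp_le)
  have "((\<lambda>s. norm (cos (r s), sin (r s) - 1, 0::real)) \<longlongrightarrow> norm (cos (pi/2), sin (pi/2) - 1, 0::real)) at_top"
    by (intro tendsto_intros r)
  then have upper: "((\<lambda>s. norm (cos (r s), sin (r s) - 1, 0::real)) \<longlongrightarrow> 0) at_top" by simp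
  show "((\<lambda>s. infdist (\<alpha> s) {(0, 1, h) | h. True}) \<longlongrightarrow> 0) at_top"
  proof (rule tendsto_sandwich[OF _ _ tendsto_const upper])
    have "infdist (\<alpha> s) {(0, 1, h) | h. True} \<le> norm (cos (r s), sin (r s) - 1, 0::real)" for s
      using infdist_le[of "(0, 1, z s)" "{(0, 1, h) | h. True}" "\<alpha> s"]
      by (simp add: gen_curve_def dist_norm)
    then show "\<forall>\<^sub>F s in at_top. infdist (\<alpha> s) {(0, 1, h) | h. True} \<le> norm (cos (r s), sin (r s) - 1, 0::real)"
      by simp
  qed (simp add: infdist_nonneg)
qed

text \<open>Up to \<open>s0\<close> the coordinate \<open>r\<close> increases strictly, afterwards it decreases strictly. Near \<open>s0\<close> each value slightly
  below the maximum is thus taken twice, while the height increases strictly; so the curve is no graph there.\<close>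

lemma turning_curve:
  assumes s0: "0 < s0" "\<rho> s0 = pi/2"
    and before: "\<And>s. 0 \<le> s \<Longrightarrow> s < s0 \<Longrightarrow> \<rho> s < pi/2" and after: "\<And>s. s0 < s \<Longrightarrow> pi/2 < \<rho> s"
  shows "fst (\<gamma> s) \<le> fst (\<gamma> s0)" and "vertical_tangent_at \<alpha> s \<longleftrightarrow> s = s0"
    and "\<not> vertical_graph_near \<alpha> s \<longleftrightarrow> s = s0"
proof -
  have before': "- pi/2 < \<rho> s \<and> \<rho> s < pi/2" if "s < s0" for s
    using before[of s] left_half(1)[OF x, of s] \<rho>_gt[of s] that pi_gt_zero by (cases "0 \<le> s") auto
  have incr: "r s < r t" if "s < t" "t \<le> s0" for s t
    using that before' by (intro r_strict_increasing x_pi) auto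
  have decr: "r t < r s" if "s0 \<le> s" "s < t" for s t
    using that after s0 by (intro r_strict_decreasing x_pi) auto
  show "r s \<le> r s0"
    using incr[of s s0] decr[of s0 s] by (cases s s0 rule: linorder_cases) auto
  show "vertical_tangent_at \<alpha> s \<longleftrightarrow> s = s0"
  proof (cases s s0 rule: linorder_cases)
    case less
    then have "0 < cos (\<rho> s)" using before'[of s] by (intro cos_gt_zero_pi) auto
    with less show ?thesis by (simp add: vertical_tangent_iff)
  next
    case greater
    then have "0 < cos (pi - \<rho> s)" using after[of s] \<rho>_in_0_pi[of s] s0 by (intro cos_gt_zero_pi) auto
    with greater show ?thesis by (simp add: vertical_tangent_iff)
  qed (simp add: vertical_tangent_iff s0)
  have near: "vertical_graph_near \<alpha> s" if "s \<noteq> s0"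
  proof -
    have "inj_on r {s - \<bar>s - s0\<bar><..<s + \<bar>s - s0\<bar>}"
    proof (rule linorder_inj_onI)
      fix u v assume "u < v" "u \<in> {s - \<bar>s - s0\<bar><..<s + \<bar>s - s0\<bar>}" "v \<in> {s - \<bar>s - s0\<bar><..<s + \<bar>s - s0\<bar>}"
      then show "r u \<noteq> r v"
        using incr[of u v] decr[of u v] by (cases s s0 rule: linorder_cases) auto
    qed auto
    then show ?thesis
      using that unfolding vertical_graph_near_def
      by (intro exI[of _ "\<bar>s - s0\<bar>"] conjI vertical_graph_if_inj) auto
  qed
  have "\<not> vertical_graph_near \<alpha> s0"
  proof
    assume "vertical_graph_near \<alpha> s0"
    then obtain e f where e: "0 < e"
      and f: "\<And>s. s \<in> {s0 - e<..<s0 + e} \<Longrightarrow> z s = f (cos (r s), sin (r s))"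
      by (auto simp: vertical_graph_near_def vertical_graph_on_def gen_curve_def)
    obtain d where d: "0 < d" "d < e" "d < s0" using dense[of 0 "min e s0"] e s0 by auto
    \<comment> \<open>A value of r that is attained on both sides of s0.\<close>
  define y where "y = max (r (s0 - d)) (r (s0 + d))"
    have y: "y < r s0" using incr[of "s0 - d" s0] decr[of s0 "s0 + d"] d by (simp add: y_def)
    obtain s1 where s1: "s0 - d \<le> s1" "s1 \<le> s0" "r s1 = y"
      using IVT'[of r "s0 - d" y s0] y d cont(1) by (auto simp: y_def)
    obtain s2 where s2: "s0 \<le> s2" "s2 \<le> s0 + d" "r s2 = y"
      using IVT2'[of r "s0 + d" y s0] y d cont(1) by (auto simp: y_def)
    have "s1 \<noteq> s0" using s1 y by auto
    then have "z s1 < z s2" using s1 s2 d by (intro height_strict_mono) auto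
    moreover have "z s1 = z s2"
      using f[of s1] f[of s2] s1 s2 d by auto
    ultimately show False by simp
  qed
  then show "\<not> vertical_graph_near \<alpha> s \<longleftrightarrow> s = s0" using near by auto
qed

text \<open>For \<open>x = pi/2\<close> the reflected orbit starts at the same point, so by uniqueness the reflection maps the orbit
  to itself with time reversed. Then \<open>sin \<rho>\<close> is odd in time, and the height is even.\<close>

lemma symmetric_curve:
  assumes "x = pi/2"
  shows "(\<lambda>(r, \<rho>). (pi - r, - \<rho>)) ` range \<gamma> = range \<gamma>"
    and "(\<lambda>(x, y, h). (- x, y, h)) ` range \<alpha> = range \<alpha>"
proof -
  have "pi - x = x" using assms by simp
  then have "launched_orbit r \<rho> (pi - x)" by (simp only: launched_orbit_axioms)
  from launched_orbit_unique[OF reflect_launched this]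
  have sym: "pi - r (- s) = r s" "- \<rho> (- s) = \<rho> s" for s by auto
  have sym': "pi - r s = r (- s)" "- \<rho> s = \<rho> (- s)" for s using sym[of "- s"] by auto
  have "((\<lambda>s. z s - z (- s)) has_real_derivative 0) (at s)" for s
  proof -
    have "((\<lambda>s. z (- s)) has_real_derivative - sin (\<rho> (- s))) (at s)"
      using z_deriv[of "- s"] by (simp only: DERIV_mirror)
    from DERIV_diff[OF z_deriv this] show ?thesis by (simp flip: sym'(2))
  qed
  then have "z s - z (- s) = z 0 - z (- 0)" for s by (intro DERIV_isconst_all) auto
  then have zs: "z (- s) = z s" for s by simp
  show "(\<lambda>(r, \<rho>). (pi - r, - \<rho>)) ` range \<gamma> = range \<gamma>"
    by (rule image_range_eq_if_reflected) (simp add: case_prod_beta sym')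
  show "(\<lambda>(x, y, h). (- x, y, h)) ` range \<alpha> = range \<alpha>"
    by (rule image_range_eq_if_reflected) (simp add: gen_curve_def zs flip: sym'(1))
qed

end

text \<open>At equal times this is the comparison of launched orbits. At equal heights the separatrix, being the lower one,
  arrives later, and it moves to the right in the meantime.\<close>

lemma separatrix_dominates:
  assumes "launched_orbit r1 \<rho>1 x" and "launched_orbit r2 \<rho>2 y"
    and sep: "\<And>s. 0 \<le> s \<Longrightarrow> 0 < cos (r2 s) \<and> \<rho>2 s < pi/2"
    and xy: "0 < x" "x < y" "y < pi" and s: "0 < s"
  shows "r1 s < r2 s" and "\<rho>1 s = \<rho>2 t \<Longrightarrow> r1 s < r2 t"
proof -
  interpret O1: launched_orbit r1 \<rho>1 x by fact
  interpret O2: launched_orbit r2 \<rho>2 y by fact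
  have c: "cos y < cos x" using xy by (intro cos_monotone_0_pi) auto
  have s0: "0 \<le> s" using s by simp
  note compare = launched_orbit_comparison[OF assms(1,2) c s0]
  have "x \<in> {0<..<pi}" "y \<in> {0<..<pi}" using xy by auto
  then have "r1 s \<in> {0<..<pi}" "r2 s \<in> {0<..<pi}"
    using O1.r_range[of s] O2.r_range[of s] unfolding O1.start O2.start by blast+
  then show less: "r1 s < r2 s"
    using compare(1) cos_mono_less_eq[of "r2 s" "r1 s"] by auto
  assume eq: "\<rho>1 s = \<rho>2 t"
  have "0 < \<rho>2 t" using O1.\<rho>_positive[OF s] eq by simp
  have t: "0 \<le> t"
  proof (rule ccontr)
    assume "\<not> 0 \<le> t"
    then have "\<rho>2 0 > 0" using O2.\<rho>_pos[of t 0] \<open>0 < \<rho>2 t\<close> by simp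
    then show False by (simp add: O2.start)
  qed
  \<comment> \<open>Otherwise the separatrix would be at time s already strictly above the other orbit.\<close>
  have "s \<le> t"
  proof (rule ccontr)
    assume "\<not> s \<le> t"
    then have "t < s" by simp
    then have "\<rho>2 t < \<rho>2 s"
    proof (rule DERIV_pos_imp_increasing)
      fix u assume u: "t \<le> u" "u \<le> s"
      then have "0 < cos (\<rho>2 u)" "0 \<le> sin (\<rho>2 u)"
        using sep[of u] O2.\<rho>_in_0_pi[of u] t by (auto intro!: cos_gt_zero_pi sin_ge_zero)
      then have "0 < 2 * cos (\<rho>2 u) + sin (\<rho>2 u) * cos (r2 u)"
        using sep[of u] u t by (intro add_pos_nonneg mult_nonneg_nonneg) auto
      with O2.\<rho>_deriv show "\<exists>d. (\<rho>2 has_real_derivative d) (at u) \<and> 0 < d" by blast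
    qed
    with compare(2) eq show False by simp
  qed
  have "r2 s \<le> r2 t"
  proof (cases "s = t")
    case False
    have "- pi/2 < \<rho>2 u \<and> \<rho>2 u < pi/2" if "s \<le> u" for u
      using sep[of u] O2.\<rho>_in_0_pi[of u] s that pi_gt_zero by auto
    then show ?thesis
      using False \<open>s \<le> t\<close> xy by (intro less_imp_le O2.r_strict_increasing) auto
  qed simp
  with less show "r1 s < r2 t" by simp
qed

theorem theorem4p4:
  fixes T :: "real \<Rightarrow> real set"
    and \<gamma> :: "real \<Rightarrow> real \<Rightarrow> real \<times> real"
    and z :: "real \<Rightarrow> real \<Rightarrow> real"
  assumes sol: "\<And>r0. r0 \<in> {0<..pi/2} \<Longrightarrow> maximal_solution (r0, 0) (T r0) (\<gamma> r0)"
    and height: "\<And>r0. r0 \<in> {0<..pi/2} \<Longrightarrow> height_function (T r0) (\<gamma> r0) (z r0)"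
  shows
   "(\<forall>r0\<in>{0<..pi/2}. T r0 = UNIV) \<and>
    \<comment> \<open>(1)\<close>
    ((\<lambda>(r, \<rho>). (pi - r, - \<rho>)) ` range (\<gamma> (pi/2)) = range (\<gamma> (pi/2)) \<and>
     (\<exists>s>0. \<gamma> (pi/2) s \<in> Lambda_curve) \<and>
     (\<gamma> (pi/2) \<longlongrightarrow> (pi, arctan 2)) at_top \<and>
     (\<exists>s<0. \<gamma> (pi/2) s \<in> Lambda_curve) \<and>
     (\<gamma> (pi/2) \<longlongrightarrow> (0, - arctan 2)) at_bot \<and>
     vertical_graph_on UNIV (gen_curve (\<gamma> (pi/2)) (z (pi/2))) \<and>
     (\<lambda>(x, y, h). (- x, y, h)) ` range (gen_curve (\<gamma> (pi/2)) (z (pi/2)))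
       = range (gen_curve (\<gamma> (pi/2)) (z (pi/2)))) \<and>
    (\<exists>rs\<in>{0<..<pi/2}.
      \<comment> \<open>(2)\<close>
      ((\<gamma> rs \<longlongrightarrow> (pi/2, pi/2)) at_top \<and>
       (\<exists>s<0. \<gamma> rs s \<in> Lambda_curve) \<and>
       (\<gamma> rs \<longlongrightarrow> (0, - arctan 2)) at_bot \<and>
       vertical_graph_on UNIV (gen_curve (\<gamma> rs) (z rs)) \<and>
       ((\<lambda>s. infdist (gen_curve (\<gamma> rs) (z rs) s) {(0, 1, h) | h. True}) \<longlongrightarrow> 0) at_top \<and>
       ((\<lambda>s. fst (\<gamma> rs s)) \<longlongrightarrow> pi/2) at_top \<and>
       filterlim (z rs) at_top at_top) \<and>
      \<comment> \<open>(3)\<close>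
      (\<forall>r0\<in>{rs<..<pi/2}.
         (\<exists>s>0. \<gamma> r0 s \<in> Lambda_curve) \<and>
         (\<gamma> r0 \<longlongrightarrow> (pi, arctan 2)) at_top \<and>
         (\<exists>s<0. \<gamma> r0 s \<in> Lambda_curve) \<and>
         (\<gamma> r0 \<longlongrightarrow> (0, - arctan 2)) at_bot \<and>
         vertical_graph_on UNIV (gen_curve (\<gamma> r0) (z r0))) \<and>
      \<comment> \<open>(4)\<close>
      (\<forall>r0\<in>{0<..<rs}.
         (\<forall>s>0. fst (\<gamma> r0 s) < fst (\<gamma> rs s)) \<and>
         (\<forall>s>0. \<forall>t. snd (\<gamma> r0 s) = snd (\<gamma> rs t) \<longrightarrow> fst (\<gamma> r0 s) < fst (\<gamma> rs t)) \<and>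
         (\<exists>s0>0. snd (\<gamma> r0 s0) = pi/2 \<and>
            (\<forall>s>0. snd (\<gamma> r0 s) = pi/2 \<longrightarrow> s = s0) \<and>
            (\<forall>s. fst (\<gamma> r0 s) \<le> fst (\<gamma> r0 s0)) \<and>
            (\<forall>s. vertical_tangent_at (gen_curve (\<gamma> r0) (z r0)) s \<longleftrightarrow> s = s0) \<and>
            (\<forall>s. \<not> vertical_graph_near (gen_curve (\<gamma> r0) (z r0)) s \<longleftrightarrow> s = s0)) \<and>
         (\<gamma> r0 \<longlongrightarrow> (0, pi - arctan 2)) at_top \<and>
         (\<exists>s<0. \<gamma> r0 s \<in> Lambda_curve) \<and>
         (\<gamma> r0 \<longlongrightarrow> (0, - arctan 2)) at_bot)) \<and>
    \<comment> \<open>all cases\<close>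
    (\<forall>r0\<in>{0<..pi/2}.
       range (gen_curve (\<gamma> r0) (z r0)) \<subseteq> {(x, y, h). y > 0 \<and> h \<ge> 0} \<and>
       (\<forall>s. snd (snd (gen_curve (\<gamma> r0) (z r0) s)) = 0 \<longleftrightarrow> s = 0) \<and>
       horizontal_tangent_at (gen_curve (\<gamma> r0) (z r0)) 0)"
proof -
  have T: "T x = UNIV" and curve: "generating_curve (\<gamma> x) x (z x)" if x: "x \<in> {0<..pi/2}" for x
  proof -
    show "T x = UNIV" by (rule maximal_solution_launched(1)[OF sol[OF x] x])
    then show "generating_curve (\<gamma> x) x (z x)"
      using maximal_solution_launched(2)[OF sol[OF x] x] height[OF x] x
      by (intro generating_curve.intro generating_curve_axioms.intro) (auto simp: height_function_def)
  qed
  have launched: "launched_orbit (\<lambda>s. fst (\<gamma> x s)) (\<lambda>s. snd (\<gamma> x s)) x" if "x \<in> {0<..pi/2}" for x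
    using maximal_solution_launched(2)[OF sol[OF that] that] .
  have half: "pi/2 \<in> {0<..pi/2}" by simp
  interpret M: generating_curve "\<gamma> (pi/2)" "pi/2" "z (pi/2)" by (rule curve[OF half])
  have mid: "\<And>s. 0 \<le> s \<Longrightarrow> snd (\<gamma> (pi/2) s) < pi/2" "\<exists>b\<ge>0. cos (fst (\<gamma> (pi/2) b)) < 0"
  proof -
    have "pi/2 \<in> {pi/2..<pi}" by simp
    note R = M.right_half[OF this]
    show "\<And>s. 0 \<le> s \<Longrightarrow> snd (\<gamma> (pi/2) s) < pi/2" by (rule R)
    show "\<exists>b\<ge>0. cos (fst (\<gamma> (pi/2) b)) < 0" using R(2)[of 1] by (intro exI[of _ 1]) simp
  qed
  obtain rs where rs: "rs \<in> {0<..<pi/2}"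
    and rs_sep: "\<And>r \<rho>. launched_orbit r \<rho> rs \<Longrightarrow> (\<forall>s\<ge>0. 0 < cos (r s) \<and> \<rho> s < pi/2)"
    using separatrix_exists by blast
  have rs': "rs \<in> {0<..pi/2}" "0 < rs" "rs < pi" using rs by auto
  have sep: "0 < cos (fst (\<gamma> rs s)) \<and> snd (\<gamma> rs s) < pi/2" if "0 \<le> s" for s
    using rs_sep[OF launched[OF rs'(1)]] that by blast
  interpret S: generating_curve "\<gamma> rs" rs "z rs" by (rule curve[OF rs'(1)])
  show ?thesis
  proof (intro conjI ballI bexI[of _ rs])
    show "T x = UNIV" if "x \<in> {0<..pi/2}" for x using T[OF that] .
  next
    show "(\<lambda>(r, \<rho>). (pi - r, - \<rho>)) ` range (\<gamma> (pi/2)) = range (\<gamma> (pi/2))"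
      "(\<lambda>(x, y, h). (- x, y, h)) ` range (gen_curve (\<gamma> (pi/2)) (z (pi/2)))
       = range (gen_curve (\<gamma> (pi/2)) (z (pi/2)))"
      using M.symmetric_curve[OF refl] by blast+
    show "\<exists>s>0. \<gamma> (pi/2) s \<in> Lambda_curve" "(\<gamma> (pi/2) \<longlongrightarrow> (pi, arctan 2)) at_top"
      using M.right_end[OF mid] by blast+
    show "\<exists>s<0. \<gamma> (pi/2) s \<in> Lambda_curve" "(\<gamma> (pi/2) \<longlongrightarrow> (0, - arctan 2)) at_bot"
      using M.left_end by blast+
    show "vertical_graph_on UNIV (gen_curve (\<gamma> (pi/2)) (z (pi/2)))"
      by (rule M.vertical_graph_UNIV[OF mid(1)])
  next
    show "(\<gamma> rs \<longlongrightarrow> (pi/2, pi/2)) at_top" "((\<lambda>s. fst (\<gamma> rs s)) \<longlongrightarrow> pi/2) at_top"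
      "filterlim (z rs) at_top at_top"
      "((\<lambda>s. infdist (gen_curve (\<gamma> rs) (z rs) s) {(0, 1, h) | h. True}) \<longlongrightarrow> 0) at_top"
      using S.saddle_curve[OF sep] by blast+
    show "\<exists>s<0. \<gamma> rs s \<in> Lambda_curve" "(\<gamma> rs \<longlongrightarrow> (0, - arctan 2)) at_bot"
      using S.left_end by blast+
    show "vertical_graph_on UNIV (gen_curve (\<gamma> rs) (z rs))"
      by (rule S.vertical_graph_UNIV) (use sep in blast)
    show "rs \<in> {0<..<pi/2}" by (rule rs)
  next
    fix r0 assume r0: "r0 \<in> {rs<..<pi/2}"
    then have r0': "r0 \<in> {0<..pi/2}" "rs < r0" "r0 < pi" using rs by auto
    interpret C: generating_curve "\<gamma> r0" r0 "z r0" by (rule curve[OF r0'(1)])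
    note right = right_of_separatrix[OF launched[OF rs'(1)] sep launched[OF r0'(1)] rs'(2) r0'(2,3)]
    show "\<exists>s>0. \<gamma> r0 s \<in> Lambda_curve" "(\<gamma> r0 \<longlongrightarrow> (pi, arctan 2)) at_top"
      using C.right_end[OF right] by blast+
    show "\<exists>s<0. \<gamma> r0 s \<in> Lambda_curve" "(\<gamma> r0 \<longlongrightarrow> (0, - arctan 2)) at_bot"
      using C.left_end by blast+
    show "vertical_graph_on UNIV (gen_curve (\<gamma> r0) (z r0))"
      by (rule C.vertical_graph_UNIV[OF right(1)])
  next
    fix r0 assume r0: "r0 \<in> {0<..<rs}"
    then have r0': "r0 \<in> {0<..pi/2}" "0 < r0" "r0 < rs" using rs by auto
    interpret C: generating_curve "\<gamma> r0" r0 "z r0" by (rule curve[OF r0'(1)])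
    note dom = separatrix_dominates[OF launched[OF r0'(1)] launched[OF rs'(1)] sep r0'(2,3) rs'(3)]
    show "\<forall>s>0. fst (\<gamma> r0 s) < fst (\<gamma> rs s)"
      "\<forall>s>0. \<forall>t. snd (\<gamma> r0 s) = snd (\<gamma> rs t) \<longrightarrow> fst (\<gamma> r0 s) < fst (\<gamma> rs t)"
      using dom by blast+
    note left = left_of_separatrix[OF launched[OF r0'(1)] launched[OF rs'(1)] sep r0'(2,3) rs'(3)]
    obtain b where b: "0 \<le> b" "pi/2 \<le> snd (\<gamma> r0 b)" using left(2) by blast
    obtain s0 where s0: "0 < s0" "snd (\<gamma> r0 s0) = pi/2"
      and before: "\<And>s. 0 \<le> s \<Longrightarrow> s < s0 \<Longrightarrow> snd (\<gamma> r0 s) < pi/2"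
      and after: "\<And>s. s0 < s \<Longrightarrow> pi/2 < snd (\<gamma> r0 s)"
      using C.turning_point[OF left(1) b] by blast
    note turning = C.turning_curve[OF s0 before after]
    have "s = s0" if "0 < s" "snd (\<gamma> r0 s) = pi/2" for s
      using before[of s] after[of s] that by (cases s s0 rule: linorder_cases) auto
    then show "\<exists>s0>0. snd (\<gamma> r0 s0) = pi/2 \<and>
            (\<forall>s>0. snd (\<gamma> r0 s) = pi/2 \<longrightarrow> s = s0) \<and>
            (\<forall>s. fst (\<gamma> r0 s) \<le> fst (\<gamma> r0 s0)) \<and>
            (\<forall>s. vertical_tangent_at (gen_curve (\<gamma> r0) (z r0)) s \<longleftrightarrow> s = s0) \<and>
            (\<forall>s. \<not> vertical_graph_near (gen_curve (\<gamma> r0) (z r0)) s \<longleftrightarrow> s = s0)"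
      using s0 turning by blast
    have "pi/2 < snd (\<gamma> r0 s)" if "s0 + 1 \<le> s" for s using after that by simp
    note corner = C.upper_left_limits[OF C.x_pi _ _ this]
    show "(\<gamma> r0 \<longlongrightarrow> (0, pi - arctan 2)) at_top"
      by (intro C.phase_tendsto corner) (use s0 left(1) in auto)
    show "\<exists>s<0. \<gamma> r0 s \<in> Lambda_curve" "(\<gamma> r0 \<longlongrightarrow> (0, - arctan 2)) at_bot"
      using C.left_end by blast+
  next
    fix r0 :: real assume r0: "r0 \<in> {0<..pi/2}"
    interpret C: generating_curve "\<gamma> r0" r0 "z r0" by (rule curve[OF r0])
    show "range (gen_curve (\<gamma> r0) (z r0)) \<subseteq> {(x, y, h). y > 0 \<and> h \<ge> 0}"
      "\<forall>s. snd (snd (gen_curve (\<gamma> r0) (z r0) s)) = 0 \<longleftrightarrow> s = 0"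
      using C.gen_curve_touches_plane by blast+
    show "horizontal_tangent_at (gen_curve (\<gamma> r0) (z r0)) 0"
      by (rule C.horizontal_tangent_0)
  qed
qed

end
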